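(* Let $R$ be a super-consistent proposition rewrite system, with generated congruence $\equiv$. Then the classical sequent calculus modulo $R$ has the cut elimination property: every sequent $\Gamma \vdash \Delta$ that is provable (possibly using the cut rule) in the classical sequent calculus modulo $R$ has a proof in that calculus which does not use the cut rule.
   Context: We work in first-order predicate logic with connectives $\wedge,\vee,\Rightarrow,\top,\bot$ and quantifiers $\forall,\exists$ (negation is $A\Rightarrow\bot$). A proposition rewrite rule is a rule $P \to A$ rewriting an atomic proposition $P$ into a proposition $A$ with $FV(A)\subseteq FV(P)$. A proposition rewrite system is an orthogonal (hence confluent) set of such rules; $\equiv$ denotes the congruence it generates. Pseudo-Heyting algebra (pHA): a structure $\langle \mathcal{B}, \leq, \tilde\top, \tilde\bot, \tilde\Rightarrow, \tilde\wedge, \tilde\vee, \tilde\forall, \tilde\exists\rangle$ where $\leq$ is a relation on the set $\mathcal{B}$, $\tilde\top,\tilde\bot\in\mathcal{B}$, $\tilde\Rightarrow,\tilde\wedge,\tilde\vee:\mathcal{B}\times\mathcal{B}\to\mathcal{B}$, and $\tilde\forall,\tilde\exists$ are functions from subsets of $\mathcal{B}$ to $\mathcal{B}$, such that for all $a,b,c$ and sets $A,E$: $\leq$ is a preorder; $a\le\tilde\top$, $\tilde\bot\le a$; $a\tilde\wedge b\le a$, $a\tilde\wedge b\le b$, and $c\le a, c\le b$ imply $c\le a\tilde\wedge b$; $a\le a\tilde\vee b$, $b\le a\tilde\vee b$, and $a\le c,b\le c$ imply $a\tilde\vee b\le c$; $\tilde\forall A\le x$ for $x\in A$ and if $b\le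 x$ for all $x\in A$ then $b\le\tilde\forall A$; $x\le\tilde\exists E$ for $x\in E$ and if $x\le b$ for all $x\in E$ then $\tilde\exists E\le b$; $a\le b\tilde\Rightarrow c$ iff $a\tilde\wedge b\le c$. It is full if $\tilde\forall,\tilde\exists$ are defined on all subsets of $\mathcal{B}$. A full pHA is ordered if it carries an additional order relation $\sqsubseteq$ on $\mathcal{B}$ such that $a\sqsubseteq b$ implies $a\le b$, $\tilde\top$ is maximal for $\sqsubseteq$, $\tilde\wedge,\tilde\vee,\tilde\forall,\tilde\exists$ are monotone and $\tilde\Rightarrow$ is antimonotone in its left and monotone in its right argument with respect to $\sqsubseteq$ (for sets, $A\sqsubseteq A'$ means every $x\in A$ has some $y\in A'$ with $x\sqsubseteq y$). It is complete if every subset of $\mathcal{B}$ has a greatest lower bound for $\sqsubseteq$. A $\tilde{\mathcal B}$-valued structure for a language assigns to each $n$-ary function symbol a function $M^n\to M$ on a domain $M$ and to each $n$-ary predicate symbol a function $M^n\to\mathcal{B}$; the denotation $[\![\cdot]\!]_\phi$ under an assignment $\phi$ of variables is defined homomorphically ($[\![\top]\!]=\tilde\top$, $[\![A\Rightarrow B]\!]=[\![A]\!]\tilde\Rightarrow[\![B]\!]$, etc., $[\![\forall x A]\!]_\phi=\tilde\forall\{[\![A]\!]_{\phi+\langle x,e\rangle}\mid e\in M\}$, similarly for $\exists$). It is a model of $R$ if $A\equiv B$ implies $[\![A]\!]_\phi=[\![B]\!]_\phi$ for all $\phi$. $R$ is super-consistent if for every full, ordered and complete pHA $\tilde{\mathcal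 B}$ it has a $\tilde{\mathcal B}$-valued model. The classical sequent calculus modulo $R$ is Gentzen's LK (axiom, cut, left/right rules for all connectives and quantifiers, left/right contraction and weakening), where the axiom $A\vdash B$ and cut on $A$ (left premise) and $B$ (right premise) require only $A\equiv B$, and each logical or contraction rule may be applied to a formula $C$ congruent (modulo $\equiv$) to the shape the rule requires.
   Formalization: In an ordered pHA, ∀̃ is required to be monotone for the dual order on sets (every y∈A' has some x∈A with x⊑y) instead of the stated one, which is kept for ∃̃; with the stated order for ∀̃ the cut elimination claim is false. *)

theory Defs
  imports Main "HOL-Library.Multiset"
begin

section \<open>First-order languages, terms and propositions\<close>

text \<open>
  Variables are de Bruijn indices: in a proposition below \<open>k\<close> quantifiers, the indices \<open>< k\<close> are
  bound and \<open>k + x\<close> is the free variable \<open>x\<close>. Propositions are thus identified up to renaming of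
  bound variables. Negation is \<open>Impl A Falsity\<close>.
\<close>

datatype 'f tm = Var nat | Fn 'f "'f tm list"

datatype ('f, 'p) fm =
    Pred 'p "'f tm list"
  | Truth
  | Falsity
  | Impl "('f, 'p) fm" "('f, 'p) fm"
  | Conj "('f, 'p) fm" "('f, 'p) fm"
  | Disj "('f, 'p) fm" "('f, 'p) fm"
  | Forall "('f, 'p) fm"
  | Exists "('f, 'p) fm"

text \<open>
  A language is a set of function symbols and a set of predicate symbols, each given with its arity.
  Both may be empty, and a name used with two arities counts as two symbols.
\<close>

record ('f, 'p) language =
  funs :: "('f \<times> nat) set"
  preds :: "('p \<times> nat) set"

fun wf_tm :: "('f, 'p) language \<Rightarrow> 'f tm \<Rightarrow> bool" where
  "wf_tm L (Var x) = True"
| "wf_tm L (Fn f ts) = ((f, length ts) \<in> funs L \<and> (\<forall>t\<in>set ts. wf_tm L t))"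

fun wf_fm :: "('f, 'p) language \<Rightarrow> ('f, 'p) fm \<Rightarrow> bool" where
  "wf_fm L (Pred p ts) = ((p, length ts) \<in> preds L \<and> (\<forall>t\<in>set ts. wf_tm L t))"
| "wf_fm L Truth = True"
| "wf_fm L Falsity = True"
| "wf_fm L (Impl A B) = (wf_fm L A \<and> wf_fm L B)"
| "wf_fm L (Conj A B) = (wf_fm L A \<and> wf_fm L B)"
| "wf_fm L (Disj A B) = (wf_fm L A \<and> wf_fm L B)"
| "wf_fm L (Forall A) = wf_fm L A"
| "wf_fm L (Exists A) = wf_fm L A"

text \<open>The variable occurrences of a term, from left to right and with repetitions.\<close>

fun vars_tm :: "'f tm \<Rightarrow> nat list" where
  "vars_tm (Var x) = [x]"
| "vars_tm (Fn f ts) = concat (map vars_tm ts)"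

fun FV :: "('f, 'p) fm \<Rightarrow> nat set" where
  "FV (Pred p ts) = (\<Union>t\<in>set ts. set (vars_tm t))"
| "FV Truth = {}"
| "FV Falsity = {}"
| "FV (Impl A B) = FV A \<union> FV B"
| "FV (Conj A B) = FV A \<union> FV B"
| "FV (Disj A B) = FV A \<union> FV B"
| "FV (Forall A) = {x. Suc x \<in> FV A}"
| "FV (Exists A) = {x. Suc x \<in> FV A}"

fun subst_tm :: "(nat \<Rightarrow> 'f tm) \<Rightarrow> 'f tm \<Rightarrow> 'f tm" where
  "subst_tm \<sigma> (Var x) = \<sigma> x"
| "subst_tm \<sigma> (Fn f ts) = Fn f (map (subst_tm \<sigma>) ts)"

definition up :: "(nat \<Rightarrow> 'f tm) \<Rightarrow> nat \<Rightarrow> 'f tm" where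
  "up \<sigma> = case_nat (Var 0) (\<lambda>x. subst_tm (\<lambda>y. Var (Suc y)) (\<sigma> x))"

fun subst_fm :: "(nat \<Rightarrow> 'f tm) \<Rightarrow> ('f, 'p) fm \<Rightarrow> ('f, 'p) fm" where
  "subst_fm \<sigma> (Pred p ts) = Pred p (map (subst_tm \<sigma>) ts)"
| "subst_fm \<sigma> Truth = Truth"
| "subst_fm \<sigma> Falsity = Falsity"
| "subst_fm \<sigma> (Impl A B) = Impl (subst_fm \<sigma> A) (subst_fm \<sigma> B)"
| "subst_fm \<sigma> (Conj A B) = Conj (subst_fm \<sigma> A) (subst_fm \<sigma> B)"
| "subst_fm \<sigma> (Disj A B) = Disj (subst_fm \<sigma> A) (subst_fm \<sigma> B)"
| "subst_fm \<sigma> (Forall A) = Forall (subst_fm (up \<sigma>) A)"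
| "subst_fm \<sigma> (Exists A) = Exists (subst_fm (up \<sigma>) A)"

text \<open>
  If \<open>A\<close> is the body of a quantifier, \<open>inst A t\<close> is \<open>A\<close> with \<open>t\<close> for the quantified variable.
  \<open>lift A\<close> is \<open>A\<close> with its free variables renumbered so that index \<open>0\<close> becomes fresh.
\<close>

definition inst :: "('f, 'p) fm \<Rightarrow> 'f tm \<Rightarrow> ('f, 'p) fm" where
  "inst A t = subst_fm (case_nat t Var) A"

definition lift :: "('f, 'p) fm \<Rightarrow> ('f, 'p) fm" where
  "lift A = subst_fm (\<lambda>x. Var (Suc x)) A"


section \<open>Proposition rewrite systems\<close>

type_synonym ('f, 'p) rule = "('f, 'p) fm \<times> ('f, 'p) fm"

fun linear :: "('f, 'p) fm \<Rightarrow> bool" where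
  "linear (Pred p ts) = distinct (concat (map vars_tm ts))"
| "linear _ = False"

text \<open>
  Only atomic propositions are rewritten and terms are not, so two left-hand sides can overlap only
  at the root. The independent substitutions rename the two rules apart.
\<close>

definition overlap :: "('f, 'p) rule \<Rightarrow> ('f, 'p) rule \<Rightarrow> bool" where
  "overlap r r' \<longleftrightarrow> (\<exists>\<sigma> \<tau>. subst_fm \<sigma> (fst r) = subst_fm \<tau> (fst r'))"

definition variant :: "('f, 'p) rule \<Rightarrow> ('f, 'p) rule \<Rightarrow> bool" where
  "variant r r' \<longleftrightarrow> (\<exists>\<pi>. bij \<pi> \<and> fst r' = subst_fm (\<lambda>x. Var (\<pi> x)) (fst r)
                              \<and> snd r' = subst_fm (\<lambda>x. Var (\<pi> x)) (snd r))"

definition orthogonal :: "('f, 'p) rule set \<Rightarrow> bool" where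
  "orthogonal R \<longleftrightarrow> (\<forall>r\<in>R. linear (fst r)) \<and> (\<forall>r\<in>R. \<forall>r'\<in>R. overlap r r' \<longrightarrow> variant r r')"

definition proposition_rewrite_system :: "('f, 'p) language \<Rightarrow> ('f, 'p) rule set \<Rightarrow> bool" where
  "proposition_rewrite_system L R \<longleftrightarrow>
     (\<forall>(P, A)\<in>R. (\<exists>p ts. P = Pred p ts) \<and> wf_fm L P \<and> wf_fm L A \<and> FV A \<subseteq> FV P) \<and> orthogonal R"

text \<open>The congruence generated by \<open>R\<close> on the propositions of the language \<open>L\<close>.\<close>

inductive cong :: "('f, 'p) language \<Rightarrow> ('f, 'p) rule set \<Rightarrow> ('f, 'p) fm \<Rightarrow> ('f, 'p) fm \<Rightarrow> bool"
  for L :: "('f, 'p) language" and R :: "('f, 'p) rule set"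
where
  cong_rewrite: "(P, A) \<in> R \<Longrightarrow> (\<And>x. wf_tm L (\<sigma> x)) \<Longrightarrow> cong L R (subst_fm \<sigma> P) (subst_fm \<sigma> A)"
| cong_refl: "wf_fm L A \<Longrightarrow> cong L R A A"
| cong_sym: "cong L R A B \<Longrightarrow> cong L R B A"
| cong_trans: "cong L R A B \<Longrightarrow> cong L R B C \<Longrightarrow> cong L R A C"
| cong_Impl: "cong L R A A' \<Longrightarrow> cong L R B B' \<Longrightarrow> cong L R (Impl A B) (Impl A' B')"
| cong_Conj: "cong L R A A' \<Longrightarrow> cong L R B B' \<Longrightarrow> cong L R (Conj A B) (Conj A' B')"
| cong_Disj: "cong L R A A' \<Longrightarrow> cong L R B B' \<Longrightarrow> cong L R (Disj A B) (Disj A' B')"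
| cong_Forall: "cong L R A A' \<Longrightarrow> cong L R (Forall A) (Forall A')"
| cong_Exists: "cong L R A A' \<Longrightarrow> cong L R (Exists A) (Exists A')"


section \<open>Pseudo-Heyting algebras\<close>

text \<open>
  \<open>carrier\<close> is the underlying set. \<open>all\<close> and \<open>ex\<close> are partial functions on its subsets, with
  domains \<open>all_dom\<close> and \<open>ex_dom\<close>.
\<close>

record 'b pha =
  carrier :: "'b set"
  le :: "'b \<Rightarrow> 'b \<Rightarrow> bool"
  tt :: 'b
  ff :: 'b
  imp :: "'b \<Rightarrow> 'b \<Rightarrow> 'b"
  con :: "'b \<Rightarrow> 'b \<Rightarrow> 'b"
  dis :: "'b \<Rightarrow> 'b \<Rightarrow> 'b"
  all_dom :: "'b set set"
  all :: "'b set \<Rightarrow> 'b"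
  ex_dom :: "'b set set"
  ex :: "'b set \<Rightarrow> 'b"

locale pseudo_heyting_algebra =
  fixes B :: "('b, 'z) pha_scheme"
  assumes tt_closed: "tt B \<in> carrier B"
    and ff_closed: "ff B \<in> carrier B"
    and imp_closed: "\<lbrakk>a \<in> carrier B; b \<in> carrier B\<rbrakk> \<Longrightarrow> imp B a b \<in> carrier B"
    and con_closed: "\<lbrakk>a \<in> carrier B; b \<in> carrier B\<rbrakk> \<Longrightarrow> con B a b \<in> carrier B"
    and dis_closed: "\<lbrakk>a \<in> carrier B; b \<in> carrier B\<rbrakk> \<Longrightarrow> dis B a b \<in> carrier B"
    and all_dom_subset: "all_dom B \<subseteq> Pow (carrier B)"
    and all_closed: "X \<in> all_dom B \<Longrightarrow> all B X \<in> carrier B"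
    and ex_dom_subset: "ex_dom B \<subseteq> Pow (carrier B)"
    and ex_closed: "X \<in> ex_dom B \<Longrightarrow> ex B X \<in> carrier B"
    and le_refl: "a \<in> carrier B \<Longrightarrow> le B a a"
    and le_trans: "\<lbrakk>a \<in> carrier B; b \<in> carrier B; c \<in> carrier B; le B a b; le B b c\<rbrakk> \<Longrightarrow> le B a c"
    and le_tt: "a \<in> carrier B \<Longrightarrow> le B a (tt B)"
    and ff_le: "a \<in> carrier B \<Longrightarrow> le B (ff B) a"
    and con_le1: "\<lbrakk>a \<in> carrier B; b \<in> carrier B\<rbrakk> \<Longrightarrow> le B (con B a b) a"
    and con_le2: "\<lbrakk>a \<in> carrier B; b \<in> carrier B\<rbrakk> \<Longrightarrow> le B (con B a b) b"
    and le_con: "\<lbrakk>a \<in> carrier B; b \<in> carrier B; c \<in> carrier B; le B c a; le B c b\<rbrakk>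
                   \<Longrightarrow> le B c (con B a b)"
    and le_dis1: "\<lbrakk>a \<in> carrier B; b \<in> carrier B\<rbrakk> \<Longrightarrow> le B a (dis B a b)"
    and le_dis2: "\<lbrakk>a \<in> carrier B; b \<in> carrier B\<rbrakk> \<Longrightarrow> le B b (dis B a b)"
    and dis_le: "\<lbrakk>a \<in> carrier B; b \<in> carrier B; c \<in> carrier B; le B a c; le B b c\<rbrakk>
                   \<Longrightarrow> le B (dis B a b) c"
    and all_le: "\<lbrakk>X \<in> all_dom B; x \<in> X\<rbrakk> \<Longrightarrow> le B (all B X) x"
    and le_all: "\<lbrakk>X \<in> all_dom B; b \<in> carrier B; \<And>x. x \<in> X \<Longrightarrow> le B b x\<rbrakk> \<Longrightarrow> le B b (all B X)"
    and le_ex: "\<lbrakk>X \<in> ex_dom B; x \<in> X\<rbrakk> \<Longrightarrow> le B x (ex B X)"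
    and ex_le: "\<lbrakk>X \<in> ex_dom B; b \<in> carrier B; \<And>x. x \<in> X \<Longrightarrow> le B x b\<rbrakk> \<Longrightarrow> le B (ex B X) b"
    and le_imp_iff: "\<lbrakk>a \<in> carrier B; b \<in> carrier B; c \<in> carrier B\<rbrakk>
                       \<Longrightarrow> le B a (imp B b c) \<longleftrightarrow> le B (con B a b) c"

locale full_pha = pseudo_heyting_algebra B
  for B :: "('b, 'z) pha_scheme" +
  assumes all_full: "all_dom B = Pow (carrier B)"
    and ex_full: "ex_dom B = Pow (carrier B)"

text \<open>\<open>sq\<close> is the additional order.\<close>

record 'b opha = "'b pha" +
  sq :: "'b \<Rightarrow> 'b \<Rightarrow> bool"

text \<open>
  The order is extended to sets in the direction in which each quantifier is monotone: \<open>ex\<close> with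
  respect to \<open>\<forall>x\<in>X. \<exists>y\<in>Y. sq x y\<close>, and \<open>all\<close>, a greatest lower bound, with respect to
  the dual \<open>\<forall>y\<in>Y. \<exists>x\<in>X. sq x y\<close>. The first extension cannot be used for \<open>all\<close>: the
  empty set lies below \<open>{ff B}\<close> for it, so it would force \<open>tt B\<close>, hence every element, to be below
  \<open>ff B\<close> for \<open>le\<close>, and not even the two-element Boolean algebra could be ordered.
  Super-consistency would then not imply cut elimination: the two rules
  \<open>M(c, s) \<rightarrow> (P \<Rightarrow> Q)\<close> and \<open>P \<rightarrow> \<exists>z. (\<forall>u. M(z, u) \<Rightarrow> M(c, u)) \<and> M(z, s)\<close> would have a model
  in every algebra, while \<open>\<turnstile> Q\<close> is provable only with cut.
\<close>

locale full_ordered_pha = full_pha B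
  for B :: "('b, 'z) opha_scheme" +
  assumes sq_refl: "a \<in> carrier B \<Longrightarrow> sq B a a"
    and sq_trans: "\<lbrakk>a \<in> carrier B; b \<in> carrier B; c \<in> carrier B; sq B a b; sq B b c\<rbrakk> \<Longrightarrow> sq B a c"
    and sq_antisym: "\<lbrakk>a \<in> carrier B; b \<in> carrier B; sq B a b; sq B b a\<rbrakk> \<Longrightarrow> a = b"
    and sq_le: "\<lbrakk>a \<in> carrier B; b \<in> carrier B; sq B a b\<rbrakk> \<Longrightarrow> le B a b"
    and tt_maximal: "\<lbrakk>a \<in> carrier B; sq B (tt B) a\<rbrakk> \<Longrightarrow> a = tt B"
    and con_mono: "\<lbrakk>a \<in> carrier B; a' \<in> carrier B; b \<in> carrier B; b' \<in> carrier B; sq B a a'; sq B b b'\<rbrakk>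
                     \<Longrightarrow> sq B (con B a b) (con B a' b')"
    and dis_mono: "\<lbrakk>a \<in> carrier B; a' \<in> carrier B; b \<in> carrier B; b' \<in> carrier B; sq B a a'; sq B b b'\<rbrakk>
                     \<Longrightarrow> sq B (dis B a b) (dis B a' b')"
    and imp_mono: "\<lbrakk>a \<in> carrier B; a' \<in> carrier B; b \<in> carrier B; b' \<in> carrier B; sq B a' a; sq B b b'\<rbrakk>
                     \<Longrightarrow> sq B (imp B a b) (imp B a' b')"
    and all_mono: "\<lbrakk>X \<subseteq> carrier B; Y \<subseteq> carrier B; \<forall>y\<in>Y. \<exists>x\<in>X. sq B x y\<rbrakk>
                     \<Longrightarrow> sq B (all B X) (all B Y)"
    and ex_mono: "\<lbrakk>X \<subseteq> carrier B; Y \<subseteq> carrier B; \<forall>x\<in>X. \<exists>y\<in>Y. sq B x y\<rbrakk>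
                     \<Longrightarrow> sq B (ex B X) (ex B Y)"

locale full_ordered_complete_pha = full_ordered_pha B
  for B :: "('b, 'z) opha_scheme" +
  assumes complete: "X \<subseteq> carrier B \<Longrightarrow>
    \<exists>g\<in>carrier B. (\<forall>x\<in>X. sq B g x) \<and> (\<forall>h\<in>carrier B. (\<forall>x\<in>X. sq B h x) \<longrightarrow> sq B h g)"


section \<open>Valued structures and super-consistency\<close>

record ('f, 'p, 'm, 'b) struct =
  domain :: "'m set"
  fn :: "'f \<Rightarrow> 'm list \<Rightarrow> 'm"
  pr :: "'p \<Rightarrow> 'm list \<Rightarrow> 'b"

definition valued_structure ::
  "('f, 'p) language \<Rightarrow> ('b, 'z) pha_scheme \<Rightarrow> ('f, 'p, 'm, 'b) struct \<Rightarrow> bool"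
where
  "valued_structure L B M \<longleftrightarrow>
     domain M \<noteq> {} \<and>
     (\<forall>(f, n)\<in>funs L. \<forall>xs. length xs = n \<and> set xs \<subseteq> domain M \<longrightarrow> fn M f xs \<in> domain M) \<and>
     (\<forall>(p, n)\<in>preds L. \<forall>xs. length xs = n \<and> set xs \<subseteq> domain M \<longrightarrow> pr M p xs \<in> carrier B)"

fun den_tm :: "('f, 'p, 'm, 'b) struct \<Rightarrow> (nat \<Rightarrow> 'm) \<Rightarrow> 'f tm \<Rightarrow> 'm" where
  "den_tm M \<phi> (Var x) = \<phi> x"
| "den_tm M \<phi> (Fn f ts) = fn M f (map (den_tm M \<phi>) ts)"

fun den :: "('b, 'z) pha_scheme \<Rightarrow> ('f, 'p, 'm, 'b) struct \<Rightarrow> (nat \<Rightarrow> 'm) \<Rightarrow> ('f, 'p) fm \<Rightarrow> 'b" where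
  "den B M \<phi> (Pred p ts) = pr M p (map (den_tm M \<phi>) ts)"
| "den B M \<phi> Truth = tt B"
| "den B M \<phi> Falsity = ff B"
| "den B M \<phi> (Impl A C) = imp B (den B M \<phi> A) (den B M \<phi> C)"
| "den B M \<phi> (Conj A C) = con B (den B M \<phi> A) (den B M \<phi> C)"
| "den B M \<phi> (Disj A C) = dis B (den B M \<phi> A) (den B M \<phi> C)"
| "den B M \<phi> (Forall A) = all B ((\<lambda>e. den B M (case_nat e \<phi>) A) ` domain M)"
| "den B M \<phi> (Exists A) = ex B ((\<lambda>e. den B M (case_nat e \<phi>) A) ` domain M)"

definition model ::
  "('f, 'p) language \<Rightarrow> ('f, 'p) rule set \<Rightarrow> ('b, 'z) pha_scheme \<Rightarrow> ('f, 'p, 'm, 'b) struct \<Rightarrow> bool"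
where
  "model L R B M \<longleftrightarrow> valued_structure L B M \<and>
     (\<forall>A C \<phi>. cong L R A C \<longrightarrow> range \<phi> \<subseteq> domain M \<longrightarrow> den B M \<phi> A = den B M \<phi> C)"

text \<open>
  HOL cannot quantify over all types inside a formula, so the two type arguments say where the
  algebras (any subset of \<open>'b\<close>) and the domains of the models (any nonempty subset of \<open>'m\<close>) live.
\<close>

definition super_consistent ::
  "'b itself \<Rightarrow> 'm itself \<Rightarrow> ('f, 'p) language \<Rightarrow> ('f, 'p) rule set \<Rightarrow> bool"
where
  "super_consistent _ _ L R \<longleftrightarrow>
     (\<forall>B :: 'b opha. full_ordered_complete_pha B \<longrightarrow>
        (\<exists>M :: ('f, 'p, 'm, 'b) struct. model L R B M))"


section \<open>The classical sequent calculus modulo\<close>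

type_synonym ('f, 'p) sequent = "('f, 'p) fm multiset \<times> ('f, 'p) fm multiset"

text \<open>
  \<open>LK cut L R \<Gamma> \<Delta>\<close>: the sequent \<open>\<Gamma> \<turnstile> \<Delta>\<close> has a proof modulo \<open>R\<close>, in which the cut
  rule may be used if and only if \<open>cut\<close> holds. In \<open>allR\<close> and \<open>exL\<close> the eigenvariable is the
  index \<open>0\<close> of the premise, which is fresh because the context is lifted.
\<close>

inductive LK ::
  "bool \<Rightarrow> ('f, 'p) language \<Rightarrow> ('f, 'p) rule set \<Rightarrow> ('f, 'p) fm multiset \<Rightarrow> ('f, 'p) fm multiset \<Rightarrow> bool"
  for cut :: bool and L :: "('f, 'p) language" and R :: "('f, 'p) rule set"
where
  ax: "cong L R A B \<Longrightarrow> LK cut L R {#A#} {#B#}"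
| cut: "\<lbrakk>cut; LK cut L R \<Gamma> (add_mset A \<Delta>); LK cut L R (add_mset B \<Gamma>) \<Delta>; cong L R A B\<rbrakk>
          \<Longrightarrow> LK cut L R \<Gamma> \<Delta>"
| weakL: "\<lbrakk>LK cut L R \<Gamma> \<Delta>; wf_fm L C\<rbrakk> \<Longrightarrow> LK cut L R (add_mset C \<Gamma>) \<Delta>"
| weakR: "\<lbrakk>LK cut L R \<Gamma> \<Delta>; wf_fm L C\<rbrakk> \<Longrightarrow> LK cut L R \<Gamma> (add_mset C \<Delta>)"
| contrL: "\<lbrakk>LK cut L R (add_mset A (add_mset B \<Gamma>)) \<Delta>; cong L R C A; cong L R C B\<rbrakk>
             \<Longrightarrow> LK cut L R (add_mset C \<Gamma>) \<Delta>"
| contrR: "\<lbrakk>LK cut L R \<Gamma> (add_mset A (add_mset B \<Delta>)); cong L R C A; cong L R C B\<rbrakk>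
             \<Longrightarrow> LK cut L R \<Gamma> (add_mset C \<Delta>)"
| topR: "\<lbrakk>cong L R C Truth; \<forall>A\<in>#\<Gamma>. wf_fm L A; \<forall>A\<in>#\<Delta>. wf_fm L A\<rbrakk>
           \<Longrightarrow> LK cut L R \<Gamma> (add_mset C \<Delta>)"
| botL: "\<lbrakk>cong L R C Falsity; \<forall>A\<in>#\<Gamma>. wf_fm L A; \<forall>A\<in>#\<Delta>. wf_fm L A\<rbrakk>
           \<Longrightarrow> LK cut L R (add_mset C \<Gamma>) \<Delta>"
| conjL: "\<lbrakk>LK cut L R (add_mset A (add_mset B \<Gamma>)) \<Delta>; cong L R C (Conj A B)\<rbrakk>
            \<Longrightarrow> LK cut L R (add_mset C \<Gamma>) \<Delta>"
| conjR: "\<lbrakk>LK cut L R \<Gamma> (add_mset A \<Delta>); LK cut L R \<Gamma> (add_mset B \<Delta>); cong L R C (Conj A B)\<rbrakk>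
            \<Longrightarrow> LK cut L R \<Gamma> (add_mset C \<Delta>)"
| disjL: "\<lbrakk>LK cut L R (add_mset A \<Gamma>) \<Delta>; LK cut L R (add_mset B \<Gamma>) \<Delta>; cong L R C (Disj A B)\<rbrakk>
            \<Longrightarrow> LK cut L R (add_mset C \<Gamma>) \<Delta>"
| disjR: "\<lbrakk>LK cut L R \<Gamma> (add_mset A (add_mset B \<Delta>)); cong L R C (Disj A B)\<rbrakk>
            \<Longrightarrow> LK cut L R \<Gamma> (add_mset C \<Delta>)"
| implL: "\<lbrakk>LK cut L R \<Gamma> (add_mset A \<Delta>); LK cut L R (add_mset B \<Gamma>) \<Delta>; cong L R C (Impl A B)\<rbrakk>
            \<Longrightarrow> LK cut L R (add_mset C \<Gamma>) \<Delta>"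
| implR: "\<lbrakk>LK cut L R (add_mset A \<Gamma>) (add_mset B \<Delta>); cong L R C (Impl A B)\<rbrakk>
            \<Longrightarrow> LK cut L R \<Gamma> (add_mset C \<Delta>)"
| allL: "\<lbrakk>LK cut L R (add_mset (inst A t) \<Gamma>) \<Delta>; wf_tm L t; cong L R C (Forall A)\<rbrakk>
           \<Longrightarrow> LK cut L R (add_mset C \<Gamma>) \<Delta>"
| allR: "\<lbrakk>LK cut L R (image_mset lift \<Gamma>) (add_mset A (image_mset lift \<Delta>)); cong L R C (Forall A)\<rbrakk>
           \<Longrightarrow> LK cut L R \<Gamma> (add_mset C \<Delta>)"
| exL: "\<lbrakk>LK cut L R (add_mset A (image_mset lift \<Gamma>)) (image_mset lift \<Delta>); cong L R C (Exists A)\<rbrakk>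
          \<Longrightarrow> LK cut L R (add_mset C \<Gamma>) \<Delta>"
| exR: "\<lbrakk>LK cut L R \<Gamma> (add_mset (inst A t) \<Delta>); wf_tm L t; cong L R C (Exists A)\<rbrakk>
          \<Longrightarrow> LK cut L R \<Gamma> (add_mset C \<Delta>)"

text \<open>
  The type in which the algebras of the super-consistency hypothesis live: sets of sequents with a
  distinguished proposition. It is as large as the powerset of the set of all propositions, whatever
  the types of symbols are. Super-consistency for algebras of arbitrary size implies
  super-consistency for algebras living in this type.
\<close>

type_synonym ('f, 'p) truth_value = "(('f, 'p) fm \<times> ('f, 'p) sequent) set"

end

theory Submission
  imports Defs "HOL-Library.Confluence" "HOL-Library.Product_Plus"
begin

text \<open>
  Sequents form a commutative monoid, and the sets of sequents closed under double orthogonality with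
  respect to cut-free provability (the facts) form a complete Boolean algebra. A truth value is a
  family of facts indexed by the propositions \<open>C\<close>, invariant under the congruence, whose value
  at \<open>C\<close> contains the sequent \<open>C \<turnstile>\<close> and is orthogonal to \<open>\<turnstile> C\<close>. These families carry
  a full, ordered and complete pseudo-Heyting algebra, hence super-consistency gives a model \<open>M\<close> in it. Reading
  the denotation of \<open>A\<close> at the proposition \<open>\<sigma> A\<close> yields a Boolean-valued interpretation
  for which the calculus with cut is sound, because congruent propositions with the same head
  connective have congruent components. A provable sequent \<open>\<Gamma> \<turnstile> \<Delta>\<close> is itself a
  point satisfying its hypotheses and refuting its conclusions, so soundness makes it cut-free provable.
\<close>

section \<open>Substitution\<close>

text \<open>The obstacle is that super-consistency yields an arbitrary model: nothing ties the value
  of a predicate to the sequents in which it occurs, and an element of the algebra does not know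
  which proposition it will interpret. Hence every truth value holds a fact for all propositions at
  once, each already confined to an interval: it contains \<open>left C\<close> and lies below
  \<open>perp {right C}\<close>. With cut the two ends of this interval would coincide; without it
  they may differ. The operations must then return an admissible fact also at a \<open>C\<close>
  whose head does not match, for instance a conjunction of truth values read at an atom. This is why
  \<open>meet\<close> is clipped by \<open>perp {right C}\<close> and \<open>join\<close> is
  enlarged by \<open>left C\<close>. The logical rules split accordingly: \<open>conjL\<close>,
  \<open>implL\<close>, \<open>disjR\<close>, \<open>allL\<close>, \<open>exR\<close> keep the
  operations inside the truth values, while \<open>conjR\<close>, \<open>implR\<close>,
  \<open>disjL\<close>, \<open>allR\<close>, \<open>exL\<close> show that at a \<open>C\<close> of
  matching shape the correction is absorbed. Cut is sound because membership in a fact can be tested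
  against its orthogonal.\<close>

lemma subst_tm_eq_iff: "subst_tm \<sigma> t = subst_tm \<tau> t \<longleftrightarrow> (\<forall>x\<in>set (vars_tm t). \<sigma> x = \<tau> x)"
  by (induction t) auto

lemma subst_tm_comp: "subst_tm \<tau> (subst_tm \<sigma> t) = subst_tm (\<lambda>x. subst_tm \<tau> (\<sigma> x)) t"
  by (induction t) auto

lemma subst_tm_Var [simp]: "subst_tm Var t = t"
  by (induction t) (auto simp: map_idI)

lemma up_0 [simp]: "up \<sigma> 0 = Var 0"
  by (simp add: up_def)

lemma up_Suc [simp]: "up \<sigma> (Suc x) = subst_tm (\<lambda>y. Var (Suc y)) (\<sigma> x)"
  by (simp add: up_def)

lemma up_comp: "(\<lambda>x. subst_tm (up \<tau>) (up \<sigma> x)) = up (\<lambda>x. subst_tm \<tau> (\<sigma> x))"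
proof
  fix x
  show "subst_tm (up \<tau>) (up \<sigma> x) = up (\<lambda>x. subst_tm \<tau> (\<sigma> x)) x"
    by (cases x) (simp_all add: subst_tm_comp)
qed

lemma up_Var [simp]: "up Var = Var"
proof
  fix x
  show "up Var x = Var x"
    by (cases x) simp_all
qed

lemma subst_fm_comp: "subst_fm \<tau> (subst_fm \<sigma> A) = subst_fm (\<lambda>x. subst_tm \<tau> (\<sigma> x)) A"
  by (induction A arbitrary: \<sigma> \<tau>) (auto simp: subst_tm_comp up_comp)

lemma subst_fm_Var [simp]: "subst_fm Var A = A"
  by (induction A) (auto simp: map_idI)

lemma subst_fm_cong: "(\<And>x. x \<in> FV A \<Longrightarrow> \<sigma> x = \<tau> x) \<Longrightarrow> subst_fm \<sigma> A = subst_fm \<tau> A"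
proof (induction A arbitrary: \<sigma> \<tau>)
  case (Pred p ts)
  then show ?case by (auto simp: subst_tm_eq_iff)
next
  case (Impl A B)
  from Impl.IH[of \<sigma> \<tau>] Impl.prems show ?case by simp
next
  case (Conj A B)
  from Conj.IH[of \<sigma> \<tau>] Conj.prems show ?case by simp
next
  case (Disj A B)
  from Disj.IH[of \<sigma> \<tau>] Disj.prems show ?case by simp
next
  case (Forall A)
  have "up \<sigma> x = up \<tau> x" if "x \<in> FV A" for x
    using that Forall.prems by (cases x) auto
  then show ?case using Forall.IH[of "up \<sigma>" "up \<tau>"] by simp
next
  case (Exists A)
  have "up \<sigma> x = up \<tau> x" if "x \<in> FV A" for x
    using that Exists.prems by (cases x) auto
  then show ?case using Exists.IH[of "up \<sigma>" "up \<tau>"] by simp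
qed simp_all

lemma finite_FV: "finite (FV A)"
proof (induction A)
  case (Forall A)
  have "FV (Forall A) = Suc -` FV A" by auto
  then show ?case using Forall by (simp add: finite_vimageI)
next
  case (Exists A)
  have "FV (Exists A) = Suc -` FV A" by auto
  then show ?case using Exists by (simp add: finite_vimageI)
qed simp_all

lemma subst_lift: "subst_fm (up \<tau>) (lift A) = lift (subst_fm \<tau> A)"
  by (simp add: lift_def subst_fm_comp)

lemma subst_case_nat_lift: "subst_fm (case_nat t \<sigma>) (lift A) = subst_fm \<sigma> A"
  by (simp add: lift_def subst_fm_comp)

text \<open>Reading the body of a quantifier in an extended environment amounts to instantiating the
  substituted quantified proposition; this is how \<open>val\<close> at
  \<open>case_nat t \<sigma>\<close> becomes a fact at an instance.\<close>

lemma subst_case_nat: "subst_fm (case_nat t \<sigma>) A = inst (subst_fm (up \<sigma>) A) t"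
proof -
  have "(\<lambda>x. subst_tm (case_nat t Var) (up \<sigma> x)) = case_nat t \<sigma>"
  proof
    fix x
    show "subst_tm (case_nat t Var) (up \<sigma> x) = case_nat t \<sigma> x"
      by (cases x) (simp_all add: subst_tm_comp)
  qed
  then show ?thesis
    by (simp add: inst_def subst_fm_comp)
qed

lemma subst_inst: "subst_fm \<sigma> (inst A t) = subst_fm (case_nat (subst_tm \<sigma> t) \<sigma>) A"
proof -
  have "(\<lambda>x. subst_tm \<sigma> (case_nat t Var x)) = case_nat (subst_tm \<sigma> t) \<sigma>"
  proof
    fix x
    show "subst_tm \<sigma> (case_nat t Var x) = case_nat (subst_tm \<sigma> t) \<sigma> x"
      by (cases x) simp_all
  qed
  then show ?thesis
    by (simp add: inst_def subst_fm_comp)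
qed

lemma wf_subst_tm: "wf_tm L t \<Longrightarrow> (\<And>x. wf_tm L (\<sigma> x)) \<Longrightarrow> wf_tm L (subst_tm \<sigma> t)"
  by (induction t) auto

lemma wf_up: "(\<And>x. wf_tm L (\<sigma> x)) \<Longrightarrow> wf_tm L (up \<sigma> x)"
  by (cases x) (simp_all add: wf_subst_tm)

lemma wf_subst_fm: "wf_fm L A \<Longrightarrow> (\<And>x. wf_tm L (\<sigma> x)) \<Longrightarrow> wf_fm L (subst_fm \<sigma> A)"
  by (induction A arbitrary: \<sigma>) (auto simp: wf_subst_tm wf_up)

lemma wf_case_nat: "wf_tm L t \<Longrightarrow> (\<And>x. wf_tm L (\<sigma> x)) \<Longrightarrow> wf_tm L (case_nat t \<sigma> x)"
  by (cases x) simp_all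

lemma wf_inst: "wf_fm L A \<Longrightarrow> wf_tm L t \<Longrightarrow> wf_fm L (inst A t)"
  by (simp add: inst_def wf_subst_fm wf_case_nat)

text \<open>A renaming changes no function or predicate symbol, so well-formedness can be read back
  through it. Needed because the premises of \<open>allR\<close> and \<open>exL\<close> only speak
  of lifted contexts.\<close>

lemma wf_subst_fm_VarD:
  assumes "wf_fm L (subst_fm (\<lambda>x. Var (f x)) A)"
  shows "wf_fm L A"
proof -
  have tm: "wf_tm L t" if "wf_tm L (subst_tm (\<lambda>x. Var (g x)) t)" for g and t :: "'a tm"
    using that by (induction t) auto
  \<comment> \<open>Renamings are closed under \<open>up\<close>, which keeps the induction inside
    the class of renamings.\<close>
  have up: "up (\<lambda>x. Var (g x)) = (\<lambda>x. Var (case_nat 0 (\<lambda>y. Suc (g y)) x) :: 'a tm)" for g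
  proof
    fix x
    show "up (\<lambda>x. Var (g x)) x = Var (case_nat 0 (\<lambda>y. Suc (g y)) x)"
      by (cases x) simp_all
  qed
  show ?thesis
    using assms by (induction A arbitrary: f) (auto simp: up dest: tm)
qed

lemma wf_lift: "wf_fm L (lift A) \<longleftrightarrow> wf_fm L A"
  unfolding lift_def by (auto intro: wf_subst_fm dest: wf_subst_fm_VarD)


section \<open>Confluence\<close>

lemma cong_subst:
  "cong L R A B \<Longrightarrow> (\<And>x. wf_tm L (\<sigma> x)) \<Longrightarrow> cong L R (subst_fm \<sigma> A) (subst_fm \<sigma> B)"
proof (induction arbitrary: \<sigma> rule: cong.induct)
  case (cong_rewrite P A \<tau>)
  then show ?case
    by (simp add: subst_fm_comp cong.cong_rewrite wf_subst_tm)
next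
  case (cong_refl A)
  then show ?case by (simp add: cong.cong_refl wf_subst_fm)
next
  case (cong_trans A B C)
  then show ?case by (meson cong.cong_trans)
qed (auto intro: cong.intros simp: wf_up)

text \<open>Redexes are atoms and substitutions touch only terms, which are never rewritten, so no
  redex contains another. A simultaneous step at disjoint positions, with right-hand sides left
  unreduced, is therefore enough for the diamond property.\<close>

inductive par :: "('f, 'p) language \<Rightarrow> ('f, 'p) rule set \<Rightarrow> ('f, 'p) fm \<Rightarrow> ('f, 'p) fm \<Rightarrow> bool"
  for L :: "('f, 'p) language" and R :: "('f, 'p) rule set"
where
  par_rewrite: "(P, A) \<in> R \<Longrightarrow> (\<And>x. wf_tm L (\<sigma> x)) \<Longrightarrow> par L R (subst_fm \<sigma> P) (subst_fm \<sigma> A)"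
| par_refl: "par L R A A"
| par_Impl: "par L R A A' \<Longrightarrow> par L R B B' \<Longrightarrow> par L R (Impl A B) (Impl A' B')"
| par_Conj: "par L R A A' \<Longrightarrow> par L R B B' \<Longrightarrow> par L R (Conj A B) (Conj A' B')"
| par_Disj: "par L R A A' \<Longrightarrow> par L R B B' \<Longrightarrow> par L R (Disj A B) (Disj A' B')"
| par_Forall: "par L R A A' \<Longrightarrow> par L R (Forall A) (Forall A')"
| par_Exists: "par L R A A' \<Longrightarrow> par L R (Exists A) (Exists A')"

locale rewrite_system =
  fixes L :: "('f, 'p) language" and R :: "('f, 'p) rule set"
  assumes system: "proposition_rewrite_system L R"
begin

abbreviation equ (infix "\<cong>" 50) where "A \<cong> B \<equiv> cong L R A B"

lemma rule_shape:
  assumes "(P, A) \<in> R"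
  obtains p ts where "P = Pred p ts" "wf_fm L P" "wf_fm L A" "FV A \<subseteq> FV P"
  using assms system unfolding proposition_rewrite_system_def by blast

lemma cong_wf: "A \<cong> B \<Longrightarrow> wf_fm L A \<and> wf_fm L B"
proof (induction rule: cong.induct)
  case (cong_rewrite P A \<sigma>)
  then show ?case by (metis rule_shape wf_subst_fm)
qed auto

text \<open>Orthogonality makes overlapping rules variants of each other, and since
  \<open>FV A \<subseteq> FV P\<close>, matching the left-hand side fixes the substitution on every
  variable of the right-hand side.\<close>

lemma reduct_unique:
  assumes "(P, A) \<in> R" "(P', A') \<in> R" "subst_fm \<sigma> P = subst_fm \<tau> P'"
  shows "subst_fm \<sigma> A = subst_fm \<tau> A'"
proof -
  have "overlap (P, A) (P', A')"
    unfolding overlap_def using assms(3) by auto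
  then have "variant (P, A) (P', A')"
    using assms(1,2) system
    unfolding proposition_rewrite_system_def orthogonal_def by blast
  then obtain f where f: "P' = subst_fm (\<lambda>x. Var (f x)) P" "A' = subst_fm (\<lambda>x. Var (f x)) A"
    unfolding variant_def by auto
  obtain p ts where P: "P = Pred p ts" "FV A \<subseteq> FV P"
    using assms(1) by (rule rule_shape)
  have "subst_fm \<sigma> P = subst_fm (\<lambda>x. \<tau> (f x)) P"
    using assms(3) f(1) by (simp add: subst_fm_comp)
  then have "\<sigma> x = \<tau> (f x)" if "x \<in> FV A" for x
    using P that by (auto simp: subst_tm_eq_iff)
  then have "subst_fm \<sigma> A = subst_fm (\<lambda>x. \<tau> (f x)) A"
    by (rule subst_fm_cong)
  then show ?thesis
    using f(2) by (simp add: subst_fm_comp)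
qed

inductive_cases par_ImplE: "par L R (Impl A B) D"
inductive_cases par_ConjE: "par L R (Conj A B) D"
inductive_cases par_DisjE: "par L R (Disj A B) D"
inductive_cases par_ForallE: "par L R (Forall A) D"
inductive_cases par_ExistsE: "par L R (Exists A) D"

text \<open>Left-hand sides are atoms and stay so under substitution. A compound proposition is thus
  never a redex, and reduction preserves its head connective.\<close>

lemma subst_rule_lhs:
  assumes "(P, A) \<in> R"
  shows "Impl B C \<noteq> subst_fm \<sigma> P" "Conj B C \<noteq> subst_fm \<sigma> P" "Disj B C \<noteq> subst_fm \<sigma> P"
    "Forall B \<noteq> subst_fm \<sigma> P" "Exists B \<noteq> subst_fm \<sigma> P"
  using assms by (auto elim: rule_shape)

lemma par_Impl_inv: "par L R (Impl A B) D \<Longrightarrow> \<exists>A' B'. D = Impl A' B' \<and> par L R A A' \<and> par L R B B'"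
  by (erule par_ImplE) (auto simp: subst_rule_lhs intro: par_refl)

lemma par_Conj_inv: "par L R (Conj A B) D \<Longrightarrow> \<exists>A' B'. D = Conj A' B' \<and> par L R A A' \<and> par L R B B'"
  by (erule par_ConjE) (auto simp: subst_rule_lhs intro: par_refl)

lemma par_Disj_inv: "par L R (Disj A B) D \<Longrightarrow> \<exists>A' B'. D = Disj A' B' \<and> par L R A A' \<and> par L R B B'"
  by (erule par_DisjE) (auto simp: subst_rule_lhs intro: par_refl)

lemma par_Forall_inv: "par L R (Forall A) D \<Longrightarrow> \<exists>A'. D = Forall A' \<and> par L R A A'"
  by (erule par_ForallE) (auto simp: subst_rule_lhs intro: par_refl)

lemma par_Exists_inv: "par L R (Exists A) D \<Longrightarrow> \<exists>A'. D = Exists A' \<and> par L R A A'"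
  by (erule par_ExistsE) (auto simp: subst_rule_lhs intro: par_refl)

text \<open>Two steps rewriting the same atom agree by \<open>reduct_unique\<close>, unless one of
  them is idle; two steps from a compound act inside the components, where the induction hypotheses
  close the diagram.\<close>

lemma par_diamond: "par L R A B \<Longrightarrow> par L R A C \<Longrightarrow> \<exists>D. par L R B D \<and> par L R C D"
proof (induction arbitrary: C rule: par.induct)
  case (par_rewrite P A \<sigma>)
  obtain p ts where P: "P = Pred p ts"
    using par_rewrite(1) by (rule rule_shape)
  from par_rewrite.prems show ?case
  proof cases
    case (par_rewrite P' A' \<tau>)
    then have "subst_fm \<sigma> A = C"
      using reduct_unique \<open>(P, A) \<in> R\<close> by metis
    then show ?thesis by (auto intro: par_refl)
  next
    case par_refl
    then show ?thesis using par_rewrite(1,2) by (blast intro: par.intros)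
  qed (simp_all add: P)
next
  case (par_refl A)
  then show ?case by (auto intro: par.par_refl)
next
  case (par_Impl A A' B B')
  then show ?case by (fast dest: par_Impl_inv intro: par.par_Impl)
next
  case (par_Conj A A' B B')
  then show ?case by (fast dest: par_Conj_inv intro: par.par_Conj)
next
  case (par_Disj A A' B B')
  then show ?case by (fast dest: par_Disj_inv intro: par.par_Disj)
next
  case (par_Forall A A')
  then show ?case by (fast dest: par_Forall_inv intro: par.par_Forall)
next
  case (par_Exists A A')
  then show ?case by (fast dest: par_Exists_inv intro: par.par_Exists)
qed

lemma par_confluent: "confluentp (par L R)"
proof (rule strong_confluentp_imp_confluentp, rule strong_confluentpI)
  fix A B C
  assume "par L R A B" "par L R A C"
  then obtain D where "par L R B D" "par L R C D"
    using par_diamond by blast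
  then show "\<exists>D. (par L R)\<^sup>*\<^sup>* B D \<and> (par L R)\<^sup>=\<^sup>= C D" by auto
qed

text \<open>The hypothesis \<open>wf_fm L A\<close> bridges the two relations:
  \<open>par_refl\<close> covers all propositions, \<open>cong_refl\<close> only those of the
  language.\<close>

lemma par_imp_cong: "par L R A B \<Longrightarrow> wf_fm L A \<Longrightarrow> A \<cong> B"
proof (induction rule: par.induct)
  case (par_rewrite P A \<sigma>)
  then show ?case by (simp add: cong.cong_rewrite)
qed (auto intro: cong.intros)

lemma pars_imp_cong: "(par L R)\<^sup>*\<^sup>* A B \<Longrightarrow> wf_fm L A \<Longrightarrow> A \<cong> B"
proof (induction rule: rtranclp_induct)
  case base
  then show ?case by (rule cong_refl)
next
  case (step B C)
  then show ?case by (meson cong_trans cong_wf par_imp_cong)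
qed

section \<open>Reduction under connectives and the Church-Rosser property\<close>

lemma pars_binary:
  assumes "\<And>A A' B B'. par L R A A' \<Longrightarrow> par L R B B' \<Longrightarrow> par L R (c A B) (c A' B')"
    and "(par L R)\<^sup>*\<^sup>* A A'" "(par L R)\<^sup>*\<^sup>* B B'"
  shows "(par L R)\<^sup>*\<^sup>* (c A B) (c A' B')"
proof -
  have "(par L R)\<^sup>*\<^sup>* (c A B) (c A' B)"
    using assms(2) by (induction rule: rtranclp_induct) (auto intro: rtranclp.rtrancl_into_rtrancl assms(1) par_refl)
  moreover have "(par L R)\<^sup>*\<^sup>* (c A' B) (c A' B')"
    using assms(3) by (induction rule: rtranclp_induct) (auto intro: rtranclp.rtrancl_into_rtrancl assms(1) par_refl)
  ultimately show ?thesis by auto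
qed

lemma pars_unary:
  assumes "\<And>A A'. par L R A A' \<Longrightarrow> par L R (c A) (c A')" and "(par L R)\<^sup>*\<^sup>* A A'"
  shows "(par L R)\<^sup>*\<^sup>* (c A) (c A')"
  using assms(2) by (induction rule: rtranclp_induct) (auto intro: rtranclp.rtrancl_into_rtrancl assms(1))

lemma pars_Impl:
  "(par L R)\<^sup>*\<^sup>* A A' \<Longrightarrow> (par L R)\<^sup>*\<^sup>* B B' \<Longrightarrow> (par L R)\<^sup>*\<^sup>* (Impl A B) (Impl A' B')"
  by (rule pars_binary[where c = Impl]) (rule par_Impl)

lemma pars_Conj:
  "(par L R)\<^sup>*\<^sup>* A A' \<Longrightarrow> (par L R)\<^sup>*\<^sup>* B B' \<Longrightarrow> (par L R)\<^sup>*\<^sup>* (Conj A B) (Conj A' B')"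
  by (rule pars_binary[where c = Conj]) (rule par_Conj)

lemma pars_Disj:
  "(par L R)\<^sup>*\<^sup>* A A' \<Longrightarrow> (par L R)\<^sup>*\<^sup>* B B' \<Longrightarrow> (par L R)\<^sup>*\<^sup>* (Disj A B) (Disj A' B')"
  by (rule pars_binary[where c = Disj]) (rule par_Disj)

lemma pars_Forall: "(par L R)\<^sup>*\<^sup>* A A' \<Longrightarrow> (par L R)\<^sup>*\<^sup>* (Forall A) (Forall A')"
  by (rule pars_unary[where c = Forall]) (rule par_Forall)

lemma pars_Exists: "(par L R)\<^sup>*\<^sup>* A A' \<Longrightarrow> (par L R)\<^sup>*\<^sup>* (Exists A) (Exists A')"
  by (rule pars_unary[where c = Exists]) (rule par_Exists)

text \<open>Beyond closure of reduction under the connectives only transitivity needs an argument: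
  the middle proposition reduces to both common reducts, which confluence joins.\<close>

lemma church_rosser: "A \<cong> B \<Longrightarrow> \<exists>D. (par L R)\<^sup>*\<^sup>* A D \<and> (par L R)\<^sup>*\<^sup>* B D"
proof (induction rule: cong.induct)
  case (cong_rewrite P A \<sigma>)
  then show ?case by (meson par_rewrite r_into_rtranclp rtranclp.rtrancl_refl)
next
  case (cong_trans A B C)
  then obtain D E where "(par L R)\<^sup>*\<^sup>* A D" "(par L R)\<^sup>*\<^sup>* B D" "(par L R)\<^sup>*\<^sup>* B E" "(par L R)\<^sup>*\<^sup>* C E"
    by blast
  then show ?case by (meson confluentpD par_confluent rtranclp_trans)
next
  case (cong_Impl A A' B B')
  then show ?case by (blast intro: pars_Impl)
next
  case (cong_Conj A A' B B')
  then show ?case by (blast intro: pars_Conj)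
next
  case (cong_Disj A A' B B')
  then show ?case by (blast intro: pars_Disj)
next
  case (cong_Forall A A')
  then show ?case by (blast intro: pars_Forall)
next
  case (cong_Exists A A')
  then show ?case by (blast intro: pars_Exists)
qed auto

section \<open>Injectivity of the connectives modulo the congruence\<close>

lemma pars_binary_inv:
  assumes "\<And>A B D. par L R (c A B) D \<Longrightarrow> \<exists>A' B'. D = c A' B' \<and> par L R A A' \<and> par L R B B'"
    and "(par L R)\<^sup>*\<^sup>* (c A B) D"
  shows "\<exists>A' B'. D = c A' B' \<and> (par L R)\<^sup>*\<^sup>* A A' \<and> (par L R)\<^sup>*\<^sup>* B B'"
  using assms(2)
proof (induction rule: rtranclp_induct)
  case (step D E)
  then show ?case by (metis assms(1) rtranclp.rtrancl_into_rtrancl)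
qed auto

lemma pars_unary_inv:
  assumes "\<And>A D. par L R (c A) D \<Longrightarrow> \<exists>A'. D = c A' \<and> par L R A A'"
    and "(par L R)\<^sup>*\<^sup>* (c A) D"
  shows "\<exists>A'. D = c A' \<and> (par L R)\<^sup>*\<^sup>* A A'"
  using assms(2)
proof (induction rule: rtranclp_induct)
  case (step D E)
  then show ?case by (metis assms(1) rtranclp.rtrancl_into_rtrancl)
qed auto

lemma cong_of_common_reduct:
  "(par L R)\<^sup>*\<^sup>* A D \<Longrightarrow> (par L R)\<^sup>*\<^sup>* B D \<Longrightarrow> wf_fm L A \<Longrightarrow> wf_fm L B \<Longrightarrow> A \<cong> B"
  by (meson cong_sym cong_trans pars_imp_cong)

lemma pars_Impl_inv:
  "(par L R)\<^sup>*\<^sup>* (Impl A B) D \<Longrightarrow> \<exists>A' B'. D = Impl A' B' \<and> (par L R)\<^sup>*\<^sup>* A A' \<and> (par L R)\<^sup>*\<^sup>* B B'"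
  by (rule pars_binary_inv[where c = Impl]) (rule par_Impl_inv)

lemma pars_Conj_inv:
  "(par L R)\<^sup>*\<^sup>* (Conj A B) D \<Longrightarrow> \<exists>A' B'. D = Conj A' B' \<and> (par L R)\<^sup>*\<^sup>* A A' \<and> (par L R)\<^sup>*\<^sup>* B B'"
  by (rule pars_binary_inv[where c = Conj]) (rule par_Conj_inv)

lemma pars_Disj_inv:
  "(par L R)\<^sup>*\<^sup>* (Disj A B) D \<Longrightarrow> \<exists>A' B'. D = Disj A' B' \<and> (par L R)\<^sup>*\<^sup>* A A' \<and> (par L R)\<^sup>*\<^sup>* B B'"
  by (rule pars_binary_inv[where c = Disj]) (rule par_Disj_inv)

lemma pars_Forall_inv: "(par L R)\<^sup>*\<^sup>* (Forall A) D \<Longrightarrow> \<exists>A'. D = Forall A' \<and> (par L R)\<^sup>*\<^sup>* A A'"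
  by (rule pars_unary_inv[where c = Forall]) (rule par_Forall_inv)

lemma pars_Exists_inv: "(par L R)\<^sup>*\<^sup>* (Exists A) D \<Longrightarrow> \<exists>A'. D = Exists A' \<and> (par L R)\<^sup>*\<^sup>* A A'"
  by (rule pars_unary_inv[where c = Exists]) (rule par_Exists_inv)

text \<open>The common reduct of both sides is still an implication, and its components are common
  reducts of the respective components. Hence the components of an implication are unique up to the
  congruence, on which \<open>val_Impl\<close> relies.\<close>

lemma cong_Impl_inj: "Impl A B \<cong> Impl A' B' \<Longrightarrow> A \<cong> A' \<and> B \<cong> B'"
proof -
  assume c: "Impl A B \<cong> Impl A' B'"
  then obtain D where "(par L R)\<^sup>*\<^sup>* (Impl A B) D" "(par L R)\<^sup>*\<^sup>* (Impl A' B') D"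
    using church_rosser by blast
  then show ?thesis
    using cong_wf[OF c] by (auto dest!: pars_Impl_inv intro: cong_of_common_reduct)
qed

lemma cong_Conj_inj: "Conj A B \<cong> Conj A' B' \<Longrightarrow> A \<cong> A' \<and> B \<cong> B'"
proof -
  assume c: "Conj A B \<cong> Conj A' B'"
  then obtain D where "(par L R)\<^sup>*\<^sup>* (Conj A B) D" "(par L R)\<^sup>*\<^sup>* (Conj A' B') D"
    using church_rosser by blast
  then show ?thesis
    using cong_wf[OF c] by (auto dest!: pars_Conj_inv intro: cong_of_common_reduct)
qed

lemma cong_Disj_inj: "Disj A B \<cong> Disj A' B' \<Longrightarrow> A \<cong> A' \<and> B \<cong> B'"
proof -
  assume c: "Disj A B \<cong> Disj A' B'"
  then obtain D where "(par L R)\<^sup>*\<^sup>* (Disj A B) D" "(par L R)\<^sup>*\<^sup>* (Disj A' B') D"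
    using church_rosser by blast
  then show ?thesis
    using cong_wf[OF c] by (auto dest!: pars_Disj_inv intro: cong_of_common_reduct)
qed

lemma cong_Forall_inj: "Forall A \<cong> Forall A' \<Longrightarrow> A \<cong> A'"
proof -
  assume c: "Forall A \<cong> Forall A'"
  then obtain D where "(par L R)\<^sup>*\<^sup>* (Forall A) D" "(par L R)\<^sup>*\<^sup>* (Forall A') D"
    using church_rosser by blast
  then show ?thesis
    using cong_wf[OF c] by (auto dest!: pars_Forall_inv intro: cong_of_common_reduct)
qed

lemma cong_Exists_inj: "Exists A \<cong> Exists A' \<Longrightarrow> A \<cong> A'"
proof -
  assume c: "Exists A \<cong> Exists A'"
  then obtain D where "(par L R)\<^sup>*\<^sup>* (Exists A) D" "(par L R)\<^sup>*\<^sup>* (Exists A') D"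
    using church_rosser by blast
  then show ?thesis
    using cong_wf[OF c] by (auto dest!: pars_Exists_inv intro: cong_of_common_reduct)
qed

lemma cong_inst: "A \<cong> B \<Longrightarrow> wf_tm L t \<Longrightarrow> inst A t \<cong> inst B t"
  unfolding inst_def by (rule cong_subst) (auto intro: wf_case_nat)


section \<open>Structural rules of the sequent calculus\<close>

lemma LK_wf: "LK b L R \<Gamma> \<Delta> \<Longrightarrow> (\<forall>A\<in>#\<Gamma>. wf_fm L A) \<and> (\<forall>A\<in>#\<Delta>. wf_fm L A)"
  by (induction rule: LK.induct) (auto dest: cong_wf simp: wf_lift)

text \<open>In \<open>allR\<close> and \<open>exL\<close> the substitution acts on the premise as
  \<open>up \<sigma>\<close>, which keeps the eigenvariable at index \<open>0\<close>. The lemma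
  serves to turn an instance at a fresh variable into such a premise.\<close>

lemma LK_subst:
  "LK b L R \<Gamma> \<Delta> \<Longrightarrow> (\<And>x. wf_tm L (\<sigma> x)) \<Longrightarrow>
   LK b L R (image_mset (subst_fm \<sigma>) \<Gamma>) (image_mset (subst_fm \<sigma>) \<Delta>)"
proof (induction arbitrary: \<sigma> rule: LK.induct)
  case (ax A B)
  then show ?case by (simp add: LK.ax cong_subst)
next
  case (cut \<Gamma> A \<Delta> B)
  then show ?case
    by - (rule LK.cut[where A = "subst_fm \<sigma> A" and B = "subst_fm \<sigma> B"], simp_all add: cong_subst)
next
  case (weakL \<Gamma> \<Delta> C)
  then show ?case by (simp add: LK.weakL wf_subst_fm)
next
  case (weakR \<Gamma> \<Delta> C)
  then show ?case by (simp add: LK.weakR wf_subst_fm)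
next
  case (contrL A B \<Gamma> \<Delta> C)
  then show ?case
    by simp (rule LK.contrL[where A = "subst_fm \<sigma> A" and B = "subst_fm \<sigma> B"], simp_all add: cong_subst)
next
  case (contrR \<Gamma> A B \<Delta> C)
  then show ?case
    by simp (rule LK.contrR[where A = "subst_fm \<sigma> A" and B = "subst_fm \<sigma> B"], simp_all add: cong_subst)
next
  case (topR C \<Gamma> \<Delta>)
  then show ?case using cong_subst[of L R C Truth \<sigma>] by (auto intro!: LK.topR simp: wf_subst_fm)
next
  case (botL C \<Gamma> \<Delta>)
  then show ?case using cong_subst[of L R C Falsity \<sigma>] by (auto intro!: LK.botL simp: wf_subst_fm)
next
  case (conjL A B \<Gamma> \<Delta> C)
  then show ?case
    using cong_subst[of L R C "Conj A B" \<sigma>]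
    by simp (rule LK.conjL[where A = "subst_fm \<sigma> A" and B = "subst_fm \<sigma> B"], simp_all)
next
  case (conjR \<Gamma> A \<Delta> B C)
  then show ?case
    using cong_subst[of L R C "Conj A B" \<sigma>]
    by simp (rule LK.conjR[where A = "subst_fm \<sigma> A" and B = "subst_fm \<sigma> B"], simp_all)
next
  case (disjL A \<Gamma> \<Delta> B C)
  then show ?case
    using cong_subst[of L R C "Disj A B" \<sigma>]
    by simp (rule LK.disjL[where A = "subst_fm \<sigma> A" and B = "subst_fm \<sigma> B"], simp_all)
next
  case (disjR \<Gamma> A B \<Delta> C)
  then show ?case
    using cong_subst[of L R C "Disj A B" \<sigma>]
    by simp (rule LK.disjR[where A = "subst_fm \<sigma> A" and B = "subst_fm \<sigma> B"], simp_all)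
next
  case (implL \<Gamma> A \<Delta> B C)
  then show ?case
    using cong_subst[of L R C "Impl A B" \<sigma>]
    by simp (rule LK.implL[where A = "subst_fm \<sigma> A" and B = "subst_fm \<sigma> B"], simp_all)
next
  case (implR A \<Gamma> B \<Delta> C)
  then show ?case
    using cong_subst[of L R C "Impl A B" \<sigma>]
    by simp (rule LK.implR[where A = "subst_fm \<sigma> A" and B = "subst_fm \<sigma> B"], simp_all)
next
  case (allL A t \<Gamma> \<Delta> C)
  have "LK b L R (add_mset (inst (subst_fm (up \<sigma>) A) (subst_tm \<sigma> t)) (image_mset (subst_fm \<sigma>) \<Gamma>))
          (image_mset (subst_fm \<sigma>) \<Delta>)"
    using allL.IH[OF allL.prems] by (simp add: subst_inst subst_case_nat)
  then show ?case
    using allL.hyps allL.prems cong_subst[of L R C "Forall A" \<sigma>]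
    by simp (rule LK.allL[where A = "subst_fm (up \<sigma>) A" and t = "subst_tm \<sigma> t"], simp_all add: wf_subst_tm)
next
  case (allR \<Gamma> A \<Delta> C)
  have "LK b L R (image_mset lift (image_mset (subst_fm \<sigma>) \<Gamma>))
          (add_mset (subst_fm (up \<sigma>) A) (image_mset lift (image_mset (subst_fm \<sigma>) \<Delta>)))"
    using allR.IH[of "up \<sigma>"] allR.prems by (simp add: wf_up multiset.map_comp o_def subst_lift)
  then show ?case
    using allR.hyps allR.prems cong_subst[of L R C "Forall A" \<sigma>]
    by simp (rule LK.allR[where A = "subst_fm (up \<sigma>) A"], simp_all)
next
  case (exL A \<Gamma> \<Delta> C)
  have "LK b L R (add_mset (subst_fm (up \<sigma>) A) (image_mset lift (image_mset (subst_fm \<sigma>) \<Gamma>)))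
          (image_mset lift (image_mset (subst_fm \<sigma>) \<Delta>))"
    using exL.IH[of "up \<sigma>"] exL.prems by (simp add: wf_up multiset.map_comp o_def subst_lift)
  then show ?case
    using exL.hyps exL.prems cong_subst[of L R C "Exists A" \<sigma>]
    by simp (rule LK.exL[where A = "subst_fm (up \<sigma>) A"], simp_all)
next
  case (exR \<Gamma> A t \<Delta> C)
  have "LK b L R (image_mset (subst_fm \<sigma>) \<Gamma>)
          (add_mset (inst (subst_fm (up \<sigma>) A) (subst_tm \<sigma> t)) (image_mset (subst_fm \<sigma>) \<Delta>))"
    using exR.IH[OF exR.prems] by (simp add: subst_inst subst_case_nat)
  then show ?case
    using exR.hyps exR.prems cong_subst[of L R C "Exists A" \<sigma>]
    by simp (rule LK.exR[where A = "subst_fm (up \<sigma>) A" and t = "subst_tm \<sigma> t"], simp_all add: wf_subst_tm)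
qed

text \<open>An instance at a fresh variable is as good as the eigenvariable premise of
  \<open>allR\<close> or \<open>exL\<close>: one substitution turns the instance back into the body
  \<open>A\<close> and lifts the context.\<close>

lemma fresh_renaming:
  fixes A :: "('f, 'p) fm" and \<Gamma> \<Delta> :: "('f, 'p) fm multiset"
  obtains y \<tau> where "\<And>x. wf_tm L (\<tau> x)" "subst_fm \<tau> (inst A (Var y)) = A"
    "image_mset (subst_fm \<tau>) \<Gamma> = image_mset lift \<Gamma>" "image_mset (subst_fm \<tau>) \<Delta> = image_mset lift \<Delta>"
proof -
  \<comment> \<open>Freshness is asked for \<open>Forall A\<close>, not for \<open>A\<close>,
    because index \<open>0\<close> of \<open>A\<close> is the quantified variable.\<close>
  have "finite (FV (Forall A) \<union> (\<Union>B\<in>set_mset (\<Gamma> + \<Delta>). FV B))"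
    using finite_FV by blast
  then obtain y where y: "y \<notin> FV (Forall A) \<union> (\<Union>B\<in>set_mset (\<Gamma> + \<Delta>). FV B)"
    using ex_new_if_finite infinite_UNIV_nat by blast
  \<comment> \<open>\<open>y\<close> becomes the eigenvariable \<open>0\<close> and all other
    indices move up by one, which agrees with \<open>lift\<close> wherever \<open>y\<close> does not
    occur.\<close>
  define \<tau> :: "nat \<Rightarrow> 'f tm" where "\<tau> = (\<lambda>z. if z = y then Var 0 else Var (Suc z))"
  have "subst_fm \<tau> (inst A (Var y)) = subst_fm Var A"
    unfolding subst_inst
  proof (rule subst_fm_cong)
    fix x
    assume "x \<in> FV A"
    then show "case_nat (subst_tm \<tau> (Var y)) \<tau> x = Var x"
      using y by (cases x) (auto simp: \<tau>_def)
  qed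
  moreover have "subst_fm \<tau> B = lift B" if "B \<in># \<Gamma> + \<Delta>" for B
    unfolding lift_def by (rule subst_fm_cong) (use that y in \<open>auto simp: \<tau>_def\<close>)
  ultimately show thesis
    by (intro that[of \<tau> y]) (auto simp: \<tau>_def intro!: image_mset_cong)
qed

text \<open>Semantic arguments deliver all instances at once rather than one premise with an
  eigenvariable; the instance at a fresh variable is enough.\<close>

lemma LK_allR_fresh:
  assumes "\<And>t. wf_tm L t \<Longrightarrow> LK b L R \<Gamma> (add_mset (inst A t) \<Delta>)" and "C \<cong> Forall A"
  shows "LK b L R \<Gamma> (add_mset C \<Delta>)"
proof -
  obtain y \<tau> where "\<And>x. wf_tm L (\<tau> x)" "subst_fm \<tau> (inst A (Var y)) = A"
    "image_mset (subst_fm \<tau>) \<Gamma> = image_mset lift \<Gamma>" "image_mset (subst_fm \<tau>) \<Delta> = image_mset lift \<Delta>"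
    using fresh_renaming[of A \<Gamma> \<Delta>] by metis
  then show ?thesis
    using LK_subst[OF assms(1)[of "Var y"], of \<tau>] assms(2) by - (rule LK.allR[where A = A], simp_all)
qed

lemma LK_exL_fresh:
  assumes "\<And>t. wf_tm L t \<Longrightarrow> LK b L R (add_mset (inst A t) \<Gamma>) \<Delta>" and "C \<cong> Exists A"
  shows "LK b L R (add_mset C \<Gamma>) \<Delta>"
proof -
  obtain y \<tau> where "\<And>x. wf_tm L (\<tau> x)" "subst_fm \<tau> (inst A (Var y)) = A"
    "image_mset (subst_fm \<tau>) \<Gamma> = image_mset lift \<Gamma>" "image_mset (subst_fm \<tau>) \<Delta> = image_mset lift \<Delta>"
    using fresh_renaming[of A \<Gamma> \<Delta>] by metis
  then show ?thesis
    using LK_subst[OF assms(1)[of "Var y"], of \<tau>] assms(2) by - (rule LK.exL[where A = A], simp_all)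
qed

lemma LK_weaken:
  assumes "LK b L R \<Gamma> \<Delta>" "\<forall>A\<in>#\<Gamma>'. wf_fm L A" "\<forall>A\<in>#\<Delta>'. wf_fm L A"
  shows "LK b L R (\<Gamma> + \<Gamma>') (\<Delta> + \<Delta>')"
proof -
  have "LK b L R (\<Gamma> + \<Gamma>') \<Delta>"
    using assms(2) by (induction \<Gamma>') (auto simp: assms(1) LK.weakL)
  then show ?thesis
    using assms(3) by (induction \<Delta>') (auto simp: LK.weakR)
qed

text \<open>The side context \<open>\<Gamma>'\<close> is general because each formula, once
  contracted to a single copy, is moved into it.\<close>

lemma LK_contract_left: "LK b L R (\<Gamma> + \<Gamma> + \<Gamma>') \<Delta> \<Longrightarrow> LK b L R (\<Gamma> + \<Gamma>') \<Delta>"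
proof (induction \<Gamma> arbitrary: \<Gamma>')
  case (add A \<Gamma>)
  then have "wf_fm L A" using LK_wf by fastforce
  then have "LK b L R (add_mset A (\<Gamma> + \<Gamma> + \<Gamma>')) \<Delta>"
    using add.prems by (auto intro: LK.contrL[where A = A and B = A] cong_refl)
  then show ?case
    using add.IH[of "add_mset A \<Gamma>'"] by simp
qed simp

lemma LK_contract_right: "LK b L R \<Gamma> (\<Delta> + \<Delta> + \<Delta>') \<Longrightarrow> LK b L R \<Gamma> (\<Delta> + \<Delta>')"
proof (induction \<Delta> arbitrary: \<Delta>')
  case (add A \<Delta>)
  then have "wf_fm L A" using LK_wf by fastforce
  then have "LK b L R \<Gamma> (add_mset A (\<Delta> + \<Delta> + \<Delta>'))"
    using add.prems by (auto intro: LK.contrR[where A = A and B = A] cong_refl)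
  then show ?case
    using add.IH[of "add_mset A \<Delta>'"] by simp
qed simp

text \<open>Conversion is not a rule of the calculus; it is weakening by \<open>C\<close> followed
  by a contraction of \<open>C\<close> and \<open>A\<close> into \<open>C\<close>.\<close>

lemma LK_cong_left: "LK b L R (add_mset A \<Gamma>) \<Delta> \<Longrightarrow> C \<cong> A \<Longrightarrow> LK b L R (add_mset C \<Gamma>) \<Delta>"
  using LK.weakL[of b L R "add_mset A \<Gamma>" \<Delta> C] cong_wf[of C A]
  by (auto intro: LK.contrL[where A = C and B = A] cong_refl)

lemma LK_cong_right: "LK b L R \<Gamma> (add_mset A \<Delta>) \<Longrightarrow> C \<cong> A \<Longrightarrow> LK b L R \<Gamma> (add_mset C \<Delta>)"
  using LK.weakR[of b L R \<Gamma> "add_mset A \<Delta>" C] cong_wf[of C A]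
  by (auto intro: LK.contrR[where A = C and B = A] cong_refl)


section \<open>Orthogonality of sequents\<close>

definition seqs :: "('f, 'p) sequent set" where
  "seqs = {s. (\<forall>A\<in>#fst s. wf_fm L A) \<and> (\<forall>A\<in>#snd s. wf_fm L A)}"

definition provable :: "('f, 'p) sequent set" where
  "provable = {s. LK False L R (fst s) (snd s)}"

definition left :: "('f, 'p) fm \<Rightarrow> ('f, 'p) sequent" where
  "left A = ({#A#}, {#})"

definition right :: "('f, 'p) fm \<Rightarrow> ('f, 'p) sequent" where
  "right A = ({#}, {#A#})"

text \<open>The orthogonal of phase semantics, with the cut-free provable sequents as pole. Thanks
  to weakening and contraction it acts on facts as Boolean complement, with \<open>provable\<close>
  as least fact.\<close>

definition perp :: "('f, 'p) sequent set \<Rightarrow> ('f, 'p) sequent set" where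
  "perp X = {s \<in> seqs. \<forall>x\<in>X. s + x \<in> provable}"

definition fact :: "('f, 'p) sequent set \<Rightarrow> bool" where
  "fact F \<longleftrightarrow> F \<subseteq> seqs \<and> perp (perp F) \<subseteq> F"

lemma seqs_add: "s + t \<in> seqs \<longleftrightarrow> s \<in> seqs \<and> t \<in> seqs"
  by (auto simp: seqs_def)

lemma left_seqs: "left A \<in> seqs \<longleftrightarrow> wf_fm L A"
  by (simp add: left_def seqs_def)

lemma right_seqs: "right A \<in> seqs \<longleftrightarrow> wf_fm L A"
  by (simp add: right_def seqs_def)

lemma provable_seqs: "s \<in> provable \<Longrightarrow> s \<in> seqs"
  unfolding provable_def seqs_def using LK_wf by blast

lemma provable_weaken: "s \<in> provable \<Longrightarrow> t \<in> seqs \<Longrightarrow> s + t \<in> provable"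
  unfolding provable_def seqs_def by (auto intro: LK_weaken)

lemma provable_contract_add: "s + s + t \<in> provable \<Longrightarrow> s + t \<in> provable"
  unfolding provable_def by simp (rule LK_contract_left, rule LK_contract_right)

lemma provable_contract: "s + s \<in> provable \<Longrightarrow> s \<in> provable"
  using provable_contract_add[of s 0] by simp

lemma perp_seqs: "perp X \<subseteq> seqs"
  by (auto simp: perp_def)

lemma perpI: "s \<in> seqs \<Longrightarrow> (\<And>x. x \<in> X \<Longrightarrow> s + x \<in> provable) \<Longrightarrow> s \<in> perp X"
  by (simp add: perp_def)

lemma perpD: "s \<in> perp X \<Longrightarrow> x \<in> X \<Longrightarrow> s + x \<in> provable"
  by (simp add: perp_def)

lemma perp_antimono: "X \<subseteq> Y \<Longrightarrow> perp Y \<subseteq> perp X"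
  by (auto simp: perp_def)

lemma perp_weaken: "s \<in> perp X \<Longrightarrow> t \<in> seqs \<Longrightarrow> s + t \<in> perp X"
proof (rule perpI)
  fix x
  assume "s \<in> perp X" "t \<in> seqs" "x \<in> X"
  then have "s + x + t \<in> provable"
    by (intro provable_weaken perpD)
  then show "s + t + x \<in> provable"
    by (simp add: add.assoc add.commute[of t])
qed (use perp_seqs seqs_add in blast)

lemma perp_insert: "perp (insert x X) = perp {x} \<inter> perp X"
  by (auto simp: perp_def)

lemma subset_perp_perp: "X \<subseteq> seqs \<Longrightarrow> X \<subseteq> perp (perp X)"
  using perpD[of _ X] by (force intro: perpI simp: add.commute)

lemma perp_perp_perp: "X \<subseteq> seqs \<Longrightarrow> perp (perp (perp X)) = perp X"
  by (intro subset_antisym perp_antimono subset_perp_perp perp_seqs)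

lemma fact_perp: "X \<subseteq> seqs \<Longrightarrow> fact (perp X)"
  by (simp add: fact_def perp_perp_perp perp_seqs)

lemma fact_seqs: "fact F \<Longrightarrow> s \<in> F \<Longrightarrow> s \<in> seqs"
  by (auto simp: fact_def)

lemma fact_perp_perp: "fact F \<Longrightarrow> perp (perp F) = F"
  by (simp add: fact_def subset_antisym subset_perp_perp)

lemma fact_weaken: "fact F \<Longrightarrow> s \<in> F \<Longrightarrow> t \<in> seqs \<Longrightarrow> s + t \<in> F"
  using perp_weaken[of s "perp F" t] by (simp add: fact_perp_perp)

text \<open>The test that takes the place of cut: to put \<open>s\<close> into a fact it is enough
  to combine it with every sequent of the orthogonal.\<close>

lemma fact_memI: "fact F \<Longrightarrow> s \<in> seqs \<Longrightarrow> (\<And>u. u \<in> perp F \<Longrightarrow> s + u \<in> provable) \<Longrightarrow> s \<in> F"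
  using perpI[of s "perp F"] by (simp add: fact_perp_perp)

lemma perp_perp_least: "F \<subseteq> G \<Longrightarrow> fact G \<Longrightarrow> perp (perp F) \<subseteq> G"
  by (metis fact_perp_perp perp_antimono)

lemma fact_Inter:
  assumes "\<And>F. F \<in> \<F> \<Longrightarrow> fact F" "\<F> \<noteq> {}"
  shows "fact (\<Inter>\<F>)"
proof -
  have "\<Inter>\<F> \<subseteq> seqs"
    using assms by (auto simp: fact_def)
  moreover have "perp (perp (\<Inter>\<F>)) \<subseteq> F" if "F \<in> \<F>" for F
    by (rule perp_perp_least) (use that assms in auto)
  ultimately show ?thesis
    by (auto simp: fact_def)
qed

text \<open>The shifted set is the orthogonal of all \<open>u + v\<close> with
  \<open>v \<in> perp F\<close>, hence closed. These shifts are the residuals from which implication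
  is built.\<close>

lemma fact_shift:
  assumes "fact F" "u \<in> seqs"
  shows "fact {s \<in> seqs. s + u \<in> F}"
  unfolding fact_def
proof (intro conjI subsetI)
  fix s
  assume s: "s \<in> perp (perp {s \<in> seqs. s + u \<in> F})"
  then have "s \<in> seqs" using perp_seqs by blast
  moreover have "s + u \<in> F"
  proof (rule fact_memI)
    fix v
    assume v: "v \<in> perp F"
    have "u + v \<in> perp {s \<in> seqs. s + u \<in> F}"
      using v assms perp_seqs by (auto simp: perp_def seqs_add ac_simps)
    then show "s + u + v \<in> provable"
      using perpD[OF s] by (simp add: add.assoc)
  qed (use assms \<open>s \<in> seqs\<close> in \<open>auto simp: seqs_add\<close>)
  ultimately show "s \<in> {s \<in> seqs. s + u \<in> F}" by simp
qed auto

section \<open>The cut-free rules as closure properties of \<open>provable\<close>\<close>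

lemma provable_ax: "A \<cong> B \<Longrightarrow> left A + right B \<in> provable"
  by (simp add: provable_def left_def right_def LK.ax)

lemma provable_cong_left: "s + left A \<in> provable \<Longrightarrow> C \<cong> A \<Longrightarrow> s + left C \<in> provable"
  by (simp add: provable_def left_def LK_cong_left)

lemma provable_cong_right: "s + right A \<in> provable \<Longrightarrow> C \<cong> A \<Longrightarrow> s + right C \<in> provable"
  by (simp add: provable_def right_def LK_cong_right)

lemma provable_TruthR: "s \<in> seqs \<Longrightarrow> s + right Truth \<in> provable"
  by (simp add: provable_def right_def seqs_def LK.topR cong_refl)

lemma provable_FalsityL: "s \<in> seqs \<Longrightarrow> s + left Falsity \<in> provable"
  by (simp add: provable_def left_def seqs_def LK.botL cong_refl)

lemma provable_conjL: "s + left A + left B \<in> provable \<Longrightarrow> C \<cong> Conj A B \<Longrightarrow> s + left C \<in> provable"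
  by (simp add: provable_def left_def) (rule LK.conjL[where A = A and B = B], simp_all add: add_mset_commute)

lemma provable_conjR:
  "s + right A \<in> provable \<Longrightarrow> s + right B \<in> provable \<Longrightarrow> C \<cong> Conj A B \<Longrightarrow> s + right C \<in> provable"
  by (simp add: provable_def right_def) (rule LK.conjR[where A = A and B = B])

lemma provable_disjL:
  "s + left A \<in> provable \<Longrightarrow> s + left B \<in> provable \<Longrightarrow> C \<cong> Disj A B \<Longrightarrow> s + left C \<in> provable"
  by (simp add: provable_def left_def) (rule LK.disjL[where A = A and B = B])

lemma provable_disjR: "s + right A + right B \<in> provable \<Longrightarrow> C \<cong> Disj A B \<Longrightarrow> s + right C \<in> provable"
  by (simp add: provable_def right_def) (rule LK.disjR[where A = A and B = B], simp_all add: add_mset_commute)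

lemma provable_implL:
  "s + right A \<in> provable \<Longrightarrow> s + left B \<in> provable \<Longrightarrow> C \<cong> Impl A B \<Longrightarrow> s + left C \<in> provable"
  by (simp add: provable_def left_def right_def) (rule LK.implL[where A = A and B = B])

lemma provable_implR: "s + left A + right B \<in> provable \<Longrightarrow> C \<cong> Impl A B \<Longrightarrow> s + right C \<in> provable"
  by (simp add: provable_def left_def right_def) (rule LK.implR[where A = A and B = B])

lemma provable_allL:
  "s + left (inst A t) \<in> provable \<Longrightarrow> wf_tm L t \<Longrightarrow> C \<cong> Forall A \<Longrightarrow> s + left C \<in> provable"
  by (simp add: provable_def left_def) (rule LK.allL[where A = A and t = t])

lemma provable_exR:
  "s + right (inst A t) \<in> provable \<Longrightarrow> wf_tm L t \<Longrightarrow> C \<cong> Exists A \<Longrightarrow> s + right C \<in> provable"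
  by (simp add: provable_def right_def) (rule LK.exR[where A = A and t = t])

lemma provable_allR:
  "(\<And>t. wf_tm L t \<Longrightarrow> s + right (inst A t) \<in> provable) \<Longrightarrow> C \<cong> Forall A \<Longrightarrow> s + right C \<in> provable"
  by (simp add: provable_def right_def) (rule LK_allR_fresh[where A = A])

lemma provable_exL:
  "(\<And>t. wf_tm L t \<Longrightarrow> s + left (inst A t) \<in> provable) \<Longrightarrow> C \<cong> Exists A \<Longrightarrow> s + left C \<in> provable"
  by (simp add: provable_def left_def) (rule LK_exL_fresh[where A = A])


section \<open>The algebra of truth values\<close>

text \<open>An interval condition: \<open>F\<close> lies between the fact generated by
  \<open>left C\<close> and \<open>perp {right C}\<close>. It plays the role of a reducibility
  candidate; for well-formed \<open>C\<close> the axiom rule makes the interval nonempty.\<close>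

definition candidate :: "('f, 'p) fm \<Rightarrow> ('f, 'p) sequent set \<Rightarrow> bool" where
  "candidate C F \<longleftrightarrow> fact F \<and> left C \<in> F \<and> F \<subseteq> perp {right C}"

text \<open>The inserted set also gives the empty family a value inside \<open>seqs\<close>.\<close>

definition meet :: "('f, 'p) fm \<Rightarrow> ('f, 'p) sequent set set \<Rightarrow> ('f, 'p) sequent set" where
  "meet C \<F> = \<Inter>(insert (perp {right C}) \<F>)"

definition join :: "('f, 'p) fm \<Rightarrow> ('f, 'p) sequent set set \<Rightarrow> ('f, 'p) sequent set" where
  "join C \<F> = perp (perp (insert (left C) (\<Union>\<F>)))"

lemma candidate_fact: "candidate C F \<Longrightarrow> fact F"
  by (simp add: candidate_def)

lemma candidate_right: "candidate C F \<Longrightarrow> s \<in> F \<Longrightarrow> s + right C \<in> provable"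
  by (auto simp: candidate_def perp_def)

lemma candidate_left: "candidate C F \<Longrightarrow> s \<in> perp F \<Longrightarrow> s + left C \<in> provable"
  by (auto simp: candidate_def perp_def)

lemma left_perp_right: "wf_fm L C \<Longrightarrow> left C \<in> perp {right C}"
  by (simp add: perp_def left_seqs provable_ax cong_refl)

text \<open>The members of \<open>\<F>\<close> are typically facts at components of
  \<open>C\<close>, so the bound \<open>perp {right C}\<close> cannot be asked of them; the clip in
  \<open>meet\<close> supplies it, and the axiom rule keeps \<open>left C\<close> inside the
  clip.\<close>

lemma candidate_meet:
  assumes "wf_fm L C" "\<And>F. F \<in> \<F> \<Longrightarrow> fact F \<and> left C \<in> F"
  shows "candidate C (meet C \<F>)"
proof -
  have "fact (meet C \<F>)"
    unfolding meet_def by (rule fact_Inter) (use assms in \<open>auto intro: fact_perp simp: right_seqs\<close>)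
  then show ?thesis
    using assms left_perp_right by (auto simp: candidate_def meet_def)
qed

text \<open>Dually, \<open>join\<close> supplies \<open>left C\<close>, and the double closure
  cannot leave \<open>perp {right C}\<close> because that set is itself a fact.\<close>

lemma candidate_join:
  assumes "wf_fm L C" "\<And>F s. F \<in> \<F> \<Longrightarrow> s \<in> F \<Longrightarrow> s \<in> seqs \<and> s + right C \<in> provable"
  shows "candidate C (join C \<F>)"
proof -
  let ?X = "insert (left C) (\<Union>\<F>)"
  have X: "?X \<subseteq> seqs" "?X \<subseteq> perp {right C}"
    using assms left_perp_right by (auto simp: left_seqs perp_def)
  have "join C \<F> \<subseteq> perp {right C}"
    unfolding join_def by (rule perp_perp_least[OF X(2)]) (simp add: assms fact_perp right_seqs)
  moreover have "left C \<in> join C \<F>"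
    unfolding join_def using subset_perp_perp[OF X(1)] by auto
  ultimately show ?thesis
    unfolding candidate_def join_def by (simp add: fact_perp perp_seqs)
qed

lemma meet_mono: "(\<And>G. G \<in> \<G> \<Longrightarrow> \<exists>F\<in>\<F>. F \<subseteq> G) \<Longrightarrow> meet C \<F> \<subseteq> meet C \<G>"
  unfolding meet_def by blast

lemma join_mono: "(\<And>F. F \<in> \<F> \<Longrightarrow> \<exists>G\<in>\<G>. F \<subseteq> G) \<Longrightarrow> join C \<F> \<subseteq> join C \<G>"
  unfolding join_def by (intro perp_antimono) blast

lemma meet_cong: "A \<cong> B \<Longrightarrow> \<F> = \<G> \<Longrightarrow> meet A \<F> = meet B \<G>"
proof -
  assume "A \<cong> B"
  then have "perp {right A} = perp {right B}"
    by (auto simp: perp_def intro: provable_cong_right cong_sym)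
  then show "\<F> = \<G> \<Longrightarrow> meet A \<F> = meet B \<G>"
    by (simp add: meet_def)
qed

lemma join_cong: "A \<cong> B \<Longrightarrow> \<F> = \<G> \<Longrightarrow> join A \<F> = join B \<G>"
proof -
  assume "A \<cong> B"
  then have "perp {left A} = perp {left B}"
    by (auto simp: perp_def intro: provable_cong_left cong_sym)
  then show "\<F> = \<G> \<Longrightarrow> join A \<F> = join B \<G>"
    unfolding join_def by (subst (1 2) perp_insert) simp
qed

text \<open>Families are coded as sets of pairs so that the order \<open>sq\<close> is plain
  inclusion.\<close>

definition at :: "('f, 'p) truth_value \<Rightarrow> ('f, 'p) fm \<Rightarrow> ('f, 'p) sequent set" where
  "at a C = {s. (C, s) \<in> a}"

definition family :: "(('f, 'p) fm \<Rightarrow> ('f, 'p) sequent set) \<Rightarrow> ('f, 'p) truth_value" where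
  "family F = {(C, s). wf_fm L C \<and> s \<in> F C}"

text \<open>Emptiness outside the language makes the coding faithful: otherwise inclusion would not
  be the pointwise order on well-formed propositions, and \<open>tt alg\<close> would not be
  greatest.\<close>

definition truth_values :: "('f, 'p) truth_value set" where
  "truth_values = {a. (\<forall>C. if wf_fm L C then candidate C (at a C) else at a C = {}) \<and>
                      (\<forall>A B. A \<cong> B \<longrightarrow> at a A = at a B)}"

lemma at_family: "wf_fm L C \<Longrightarrow> at (family F) C = F C"
  by (simp add: at_def family_def)

lemma at_mono: "a \<subseteq> b \<Longrightarrow> at a C \<subseteq> at b C"
  by (auto simp: at_def)

lemma at_candidate: "a \<in> truth_values \<Longrightarrow> wf_fm L C \<Longrightarrow> candidate C (at a C)"
  by (auto simp: truth_values_def split: if_splits)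

lemma at_cong: "a \<in> truth_values \<Longrightarrow> A \<cong> B \<Longrightarrow> at a A = at a B"
  by (auto simp: truth_values_def)

lemma truth_valueI:
  assumes "\<And>C. wf_fm L C \<Longrightarrow> candidate C (F C)" "\<And>A B. A \<cong> B \<Longrightarrow> F A = F B"
  shows "family F \<in> truth_values"
proof -
  have "at (family F) A = at (family F) B" if "A \<cong> B" for A B
    using assms(2)[OF that] cong_wf[OF that] by (simp add: at_family)
  then show ?thesis
    using assms(1) by (auto simp: truth_values_def at_family) (auto simp: at_def family_def)
qed

lemma truth_value_subsetI:
  "a \<in> truth_values \<Longrightarrow> (\<And>C. wf_fm L C \<Longrightarrow> at a C \<subseteq> F C) \<Longrightarrow> a \<subseteq> family F"
  by (fastforce simp: truth_values_def at_def family_def split: if_splits)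

lemma family_mono: "(\<And>C. F C \<subseteq> G C) \<Longrightarrow> family F \<subseteq> family G"
  by (auto simp: family_def)

text \<open>
  Collecting all decompositions of \<open>C\<close> makes the operations invariant under the congruence;
  confluence makes the decompositions agree.
\<close>

definition con_facts where
  "con_facts a b C = {F. \<exists>A B. C \<cong> Conj A B \<and> (F = at a A \<or> F = at b B)}"

text \<open>The residual of \<open>at a A\<close> into \<open>at b B\<close> is split into one shift
  per \<open>u\<close>, so that each member is a fact by \<open>fact_shift\<close>.\<close>

definition imp_facts where
  "imp_facts a b C = {F. \<exists>A B u. C \<cong> Impl A B \<and> u \<in> at a A \<and> F = {s \<in> seqs. s + u \<in> at b B}}"

definition dis_facts where
  "dis_facts a b C = {F. \<exists>A B. C \<cong> Disj A B \<and> (F = at a A \<or> F = at b B)}"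

text \<open>\<open>t\<close> and \<open>x\<close> range independently, since a set of truth values
  does not record which term an element goes with.\<close>

definition all_facts where
  "all_facts X C = {F. \<exists>A t x. C \<cong> Forall A \<and> wf_tm L t \<and> x \<in> X \<and> F = at x (inst A t)}"

definition ex_facts where
  "ex_facts X C = {F. \<exists>A t x. C \<cong> Exists A \<and> wf_tm L t \<and> x \<in> X \<and> F = at x (inst A t)}"

text \<open>
  With the trivial preorder every law of a pseudo-Heyting algebra that does not involve \<open>sq\<close>
  holds, so that only monotonicity and completeness of the family order remain to be checked.
\<close>

definition alg :: "('f, 'p) truth_value opha" where
  "alg = \<lparr>carrier = truth_values, le = (\<lambda>_ _. True),
     tt = family (\<lambda>C. meet C {}), ff = family (\<lambda>C. join C {}),
     imp = (\<lambda>a b. family (\<lambda>C. meet C (imp_facts a b C))),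
     con = (\<lambda>a b. family (\<lambda>C. meet C (con_facts a b C))),
     dis = (\<lambda>a b. family (\<lambda>C. join C (dis_facts a b C))),
     all_dom = Pow truth_values, all = (\<lambda>X. family (\<lambda>C. meet C (all_facts X C))),
     ex_dom = Pow truth_values, ex = (\<lambda>X. family (\<lambda>C. join C (ex_facts X C))),
     sq = (\<subseteq>)\<rparr>"

lemma alg_ops:
  "carrier alg = truth_values"
  "tt alg = family (\<lambda>C. meet C {})"
  "ff alg = family (\<lambda>C. join C {})"
  "imp alg a b = family (\<lambda>C. meet C (imp_facts a b C))"
  "con alg a b = family (\<lambda>C. meet C (con_facts a b C))"
  "dis alg a b = family (\<lambda>C. join C (dis_facts a b C))"
  "all alg X = family (\<lambda>C. meet C (all_facts X C))"
  "ex alg X = family (\<lambda>C. join C (ex_facts X C))"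
  by (simp_all add: alg_def)

lemma cong_subst_left: "A \<cong> B \<Longrightarrow> A \<cong> C \<longleftrightarrow> B \<cong> C"
  by (meson cong_sym cong_trans)

section \<open>Closure of the truth values under the operations\<close>

lemma tt_truth_value: "family (\<lambda>C. meet C {}) \<in> truth_values"
  by (rule truth_valueI) (rule candidate_meet meet_cong; simp)+

lemma ff_truth_value: "family (\<lambda>C. join C {}) \<in> truth_values"
  by (rule truth_valueI) (rule candidate_join join_cong; simp)+

text \<open>The point is that \<open>left C\<close> belongs to the fact of each conjunct. Tested
  against \<open>v \<in> perp F\<close>, this is the rule \<open>conjL\<close>, with the other
  conjunct added by weakening.\<close>

lemma con_truth_value:
  assumes "a \<in> truth_values" "b \<in> truth_values"
  shows "family (\<lambda>C. meet C (con_facts a b C)) \<in> truth_values"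
proof (rule truth_valueI)
  fix C
  assume "wf_fm L C"
  then show "candidate C (meet C (con_facts a b C))"
  proof (rule candidate_meet)
    fix F
    assume "F \<in> con_facts a b C"
    then obtain A B where C: "C \<cong> Conj A B" and F: "F = at a A \<or> F = at b B"
      by (auto simp: con_facts_def)
    have wf: "wf_fm L A" "wf_fm L B" "wf_fm L C"
      using cong_wf[OF C] by auto
    have cand: "candidate A (at a A)" "candidate B (at b B)"
      using assms wf at_candidate by auto
    have "left C + v \<in> provable" if v: "v \<in> perp F" for v
    proof -
      have "v + left A + left B \<in> provable"
      proof (cases "F = at a A")
        case True
        then show ?thesis
          using v by (intro provable_weaken[OF candidate_left[OF cand(1)]]) (simp_all add: left_seqs wf)
      next
        case False
        then have "v + left B + left A \<in> provable"
          using v F by (intro provable_weaken[OF candidate_left[OF cand(2)]]) (simp_all add: left_seqs wf)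
        then show ?thesis by (simp add: ac_simps)
      qed
      then show ?thesis
        using provable_conjL[OF _ C] by (simp add: add.commute)
    qed
    moreover have "fact F"
      using F cand by (auto simp: candidate_fact)
    ultimately show "fact F \<and> left C \<in> F"
      using fact_memI wf by (simp add: left_seqs)
  qed
next
  fix A B
  assume "A \<cong> B"
  then show "meet A (con_facts a b A) = meet B (con_facts a b B)"
    by (rule meet_cong) (simp add: con_facts_def cong_subst_left[OF \<open>A \<cong> B\<close>])
qed

text \<open>Testing \<open>left C + u\<close> against \<open>v\<close> orthogonal to
  \<open>at b B\<close> gives an instance of \<open>implL\<close>: \<open>u\<close> provides the
  premise with \<open>right A\<close>, \<open>v\<close> the one with \<open>left B\<close>, each
  weakened by the other.\<close>

lemma imp_truth_value:
  assumes "a \<in> truth_values" "b \<in> truth_values"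
  shows "family (\<lambda>C. meet C (imp_facts a b C)) \<in> truth_values"
proof (rule truth_valueI)
  fix C
  assume "wf_fm L C"
  then show "candidate C (meet C (imp_facts a b C))"
  proof (rule candidate_meet)
    fix F
    assume "F \<in> imp_facts a b C"
    then obtain A B u where C: "C \<cong> Impl A B" and u: "u \<in> at a A"
      and F: "F = {s \<in> seqs. s + u \<in> at b B}"
      by (auto simp: imp_facts_def)
    have wf: "wf_fm L A" "wf_fm L B" "wf_fm L C"
      using cong_wf[OF C] by auto
    have cand: "candidate A (at a A)" "candidate B (at b B)"
      using assms wf at_candidate by auto
    have useq: "u \<in> seqs"
      using fact_seqs[OF candidate_fact[OF cand(1)] u] .
    have "left C + u \<in> at b B"
    proof (rule fact_memI)
      fix v
      assume v: "v \<in> perp (at b B)"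
      then have vseq: "v \<in> seqs" using perp_seqs by blast
      have "u + right A + v \<in> provable"
        by (rule provable_weaken[OF candidate_right[OF cand(1) u] vseq])
      moreover have "v + left B + u \<in> provable"
        by (rule provable_weaken[OF candidate_left[OF cand(2) v] useq])
      ultimately have "u + v + left C \<in> provable"
        using provable_implL[OF _ _ C, of "u + v"] by (simp add: ac_simps)
      then show "left C + u + v \<in> provable"
        by (simp add: ac_simps)
    qed (use cand wf useq in \<open>auto simp: candidate_fact seqs_add left_seqs\<close>)
    then show "fact F \<and> left C \<in> F"
      using F cand wf useq by (simp add: fact_shift candidate_fact left_seqs)
  qed
next
  fix A B
  assume "A \<cong> B"
  then show "meet A (imp_facts a b A) = meet B (imp_facts a b B)"
    by (rule meet_cong) (simp add: imp_facts_def cong_subst_left[OF \<open>A \<cong> B\<close>])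
qed

text \<open>Here the upper bound is at stake: \<open>disjR\<close> transfers orthogonality to
  \<open>right A\<close> or \<open>right B\<close> into orthogonality to
  \<open>right C\<close>.\<close>

lemma dis_truth_value:
  assumes "a \<in> truth_values" "b \<in> truth_values"
  shows "family (\<lambda>C. join C (dis_facts a b C)) \<in> truth_values"
proof (rule truth_valueI)
  fix C
  assume "wf_fm L C"
  then show "candidate C (join C (dis_facts a b C))"
  proof (rule candidate_join)
    fix F s
    assume "F \<in> dis_facts a b C" and s: "s \<in> F"
    then obtain A B where C: "C \<cong> Disj A B" and F: "F = at a A \<or> F = at b B"
      by (auto simp: dis_facts_def)
    have wf: "wf_fm L A" "wf_fm L B" "wf_fm L C"
      using cong_wf[OF C] by auto
    have cand: "candidate A (at a A)" "candidate B (at b B)"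
      using assms wf at_candidate by auto
    have "s + right A + right B \<in> provable"
    proof (cases "F = at a A")
      case True
      then show ?thesis
        using s by (intro provable_weaken[OF candidate_right[OF cand(1)]]) (simp_all add: right_seqs wf)
    next
      case False
      then have "s + right B + right A \<in> provable"
        using s F by (intro provable_weaken[OF candidate_right[OF cand(2)]]) (simp_all add: right_seqs wf)
      then show ?thesis by (simp add: ac_simps)
    qed
    then show "s \<in> seqs \<and> s + right C \<in> provable"
      using provable_disjR[OF _ C] provable_seqs seqs_add by blast
  qed
next
  fix A B
  assume "A \<cong> B"
  then show "join A (dis_facts a b A) = join B (dis_facts a b B)"
    by (rule join_cong) (simp add: dis_facts_def cong_subst_left[OF \<open>A \<cong> B\<close>])
qed

lemma all_truth_value:
  assumes "X \<subseteq> truth_values"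
  shows "family (\<lambda>C. meet C (all_facts X C)) \<in> truth_values"
proof (rule truth_valueI)
  fix C
  assume "wf_fm L C"
  then show "candidate C (meet C (all_facts X C))"
  proof (rule candidate_meet)
    fix F
    assume "F \<in> all_facts X C"
    then obtain A t x where C: "C \<cong> Forall A" and t: "wf_tm L t" and x: "x \<in> X"
      and F: "F = at x (inst A t)"
      by (auto simp: all_facts_def)
    have wf: "wf_fm L (inst A t)" "wf_fm L C"
      using cong_wf[OF C] t by (auto simp: wf_inst)
    have cand: "candidate (inst A t) F"
      unfolding F using assms wf x by (auto intro: at_candidate)
    have "left C + v \<in> provable" if "v \<in> perp F" for v
      using provable_allL[OF candidate_left[OF cand that] t C] by (simp add: add.commute)
    moreover have "fact F"
      using cand by (rule candidate_fact)
    ultimately show "fact F \<and> left C \<in> F"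
      using fact_memI wf by (simp add: left_seqs)
  qed
next
  fix A B
  assume "A \<cong> B"
  then show "meet A (all_facts X A) = meet B (all_facts X B)"
    by (rule meet_cong) (simp add: all_facts_def cong_subst_left[OF \<open>A \<cong> B\<close>])
qed

lemma ex_truth_value:
  assumes "X \<subseteq> truth_values"
  shows "family (\<lambda>C. join C (ex_facts X C)) \<in> truth_values"
proof (rule truth_valueI)
  fix C
  assume "wf_fm L C"
  then show "candidate C (join C (ex_facts X C))"
  proof (rule candidate_join)
    fix F s
    assume "F \<in> ex_facts X C" and s: "s \<in> F"
    then obtain A t x where C: "C \<cong> Exists A" and t: "wf_tm L t" and x: "x \<in> X"
      and F: "F = at x (inst A t)"
      by (auto simp: ex_facts_def)
    have "wf_fm L (inst A t)"
      using cong_wf[OF C] t by (auto simp: wf_inst)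
    then have "candidate (inst A t) F"
      unfolding F using assms x by (auto intro: at_candidate)
    then have "s + right C \<in> provable"
      using provable_exR[OF candidate_right t C] s by blast
    then show "s \<in> seqs \<and> s + right C \<in> provable"
      using provable_seqs seqs_add by blast
  qed
next
  fix A B
  assume "A \<cong> B"
  then show "join A (ex_facts X A) = join B (ex_facts X B)"
    by (rule join_cong) (simp add: ex_facts_def cong_subst_left[OF \<open>A \<cong> B\<close>])
qed

text \<open>Greatest lower bounds are pointwise intersections; for empty \<open>X\<close> the clip
  yields the greatest candidate.\<close>

lemma glb_truth_value:
  assumes "X \<subseteq> truth_values"
  shows "family (\<lambda>C. meet C ((\<lambda>x. at x C) ` X)) \<in> truth_values"
proof (rule truth_valueI)
  fix C
  assume C: "wf_fm L C"
  then show "candidate C (meet C ((\<lambda>x. at x C) ` X))"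
  proof (rule candidate_meet)
    fix F
    assume "F \<in> (\<lambda>x. at x C) ` X"
    then have "candidate C F"
      using assms C at_candidate by blast
    then show "fact F \<and> left C \<in> F"
      by (simp add: candidate_def)
  qed
next
  fix A B
  assume "A \<cong> B"
  then show "meet A ((\<lambda>x. at x A) ` X) = meet B ((\<lambda>x. at x B) ` X)"
    using assms at_cong by (intro meet_cong image_cong) blast+
qed

section \<open>Monotonicity of the operations and completeness of the order\<close>

lemma con_facts_mono:
  assumes "\<And>C. at a C \<subseteq> at a' C" "\<And>C. at b C \<subseteq> at b' C"
  shows "meet C (con_facts a b C) \<subseteq> meet C (con_facts a' b' C)"
proof (rule meet_mono)
  fix G
  assume "G \<in> con_facts a' b' C"
  then obtain A B where "C \<cong> Conj A B" "G = at a' A \<or> G = at b' B"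
    by (auto simp: con_facts_def)
  then have "at a A \<in> con_facts a b C" "at b B \<in> con_facts a b C" "at a A \<subseteq> G \<or> at b B \<subseteq> G"
    using assms by (auto simp: con_facts_def)
  then show "\<exists>F\<in>con_facts a b C. F \<subseteq> G" by blast
qed

lemma dis_facts_mono:
  assumes "\<And>C. at a C \<subseteq> at a' C" "\<And>C. at b C \<subseteq> at b' C"
  shows "join C (dis_facts a b C) \<subseteq> join C (dis_facts a' b' C)"
proof (rule join_mono)
  fix F
  assume "F \<in> dis_facts a b C"
  then obtain A B where "C \<cong> Disj A B" "F = at a A \<or> F = at b B"
    by (auto simp: dis_facts_def)
  then have "at a' A \<in> dis_facts a' b' C" "at b' B \<in> dis_facts a' b' C" "F \<subseteq> at a' A \<or> F \<subseteq> at b' B"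
    using assms by (auto simp: dis_facts_def)
  then show "\<exists>G\<in>dis_facts a' b' C. F \<subseteq> G" by blast
qed

text \<open>A smaller first argument offers fewer shifts to intersect, and a larger second one makes
  each shift larger.\<close>

lemma imp_facts_mono:
  assumes "\<And>C. at a' C \<subseteq> at a C" "\<And>C. at b C \<subseteq> at b' C"
  shows "meet C (imp_facts a b C) \<subseteq> meet C (imp_facts a' b' C)"
proof (rule meet_mono)
  fix G
  assume "G \<in> imp_facts a' b' C"
  then obtain A B u where C: "C \<cong> Impl A B" and u: "u \<in> at a' A" and G: "G = {s \<in> seqs. s + u \<in> at b' B}"
    unfolding imp_facts_def by blast
  have "{s \<in> seqs. s + u \<in> at b B} \<in> imp_facts a b C"
    using C u assms unfolding imp_facts_def by blast
  moreover have "{s \<in> seqs. s + u \<in> at b B} \<subseteq> G"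
    using assms G by blast
  ultimately show "\<exists>F\<in>imp_facts a b C. F \<subseteq> G" by blast
qed

lemma all_facts_mono:
  assumes "\<forall>y\<in>Y. \<exists>x\<in>X. x \<subseteq> y"
  shows "meet C (all_facts X C) \<subseteq> meet C (all_facts Y C)"
proof (rule meet_mono)
  fix G
  assume "G \<in> all_facts Y C"
  then obtain A t y where C: "C \<cong> Forall A" "wf_tm L t" and "y \<in> Y" and G: "G = at y (inst A t)"
    unfolding all_facts_def by blast
  then obtain x where x: "x \<in> X" "x \<subseteq> y"
    using assms by blast
  then have "at x (inst A t) \<in> all_facts X C"
    using C unfolding all_facts_def by blast
  then show "\<exists>F\<in>all_facts X C. F \<subseteq> G"
    using at_mono[OF x(2)] G by blast
qed

lemma ex_facts_mono:
  assumes "\<forall>x\<in>X. \<exists>y\<in>Y. x \<subseteq> y"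
  shows "join C (ex_facts X C) \<subseteq> join C (ex_facts Y C)"
proof (rule join_mono)
  fix F
  assume "F \<in> ex_facts X C"
  then obtain A t x where C: "C \<cong> Exists A" "wf_tm L t" and "x \<in> X" and F: "F = at x (inst A t)"
    unfolding ex_facts_def by blast
  then obtain y where y: "y \<in> Y" "x \<subseteq> y"
    using assms by blast
  then have "at y (inst A t) \<in> ex_facts Y C"
    using C unfolding ex_facts_def by blast
  then show "\<exists>G\<in>ex_facts Y C. F \<subseteq> G"
    using at_mono[OF y(2)] F by blast
qed

lemma alg_complete:
  assumes X: "X \<subseteq> truth_values"
  shows "\<exists>g\<in>truth_values. (\<forall>x\<in>X. g \<subseteq> x) \<and> (\<forall>h\<in>truth_values. (\<forall>x\<in>X. h \<subseteq> x) \<longrightarrow> h \<subseteq> g)"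
proof (intro bexI[OF _ glb_truth_value[OF X]] conjI ballI impI)
  fix x
  assume "x \<in> X"
  then show "family (\<lambda>C. meet C ((\<lambda>x. at x C) ` X)) \<subseteq> x"
    by (auto simp: family_def meet_def at_def)
next
  fix h
  assume h: "h \<in> truth_values" "\<forall>x\<in>X. h \<subseteq> x"
  show "h \<subseteq> family (\<lambda>C. meet C ((\<lambda>x. at x C) ` X))"
  proof (rule truth_value_subsetI[OF h(1)])
    fix C
    assume "wf_fm L C"
    then have "at h C \<subseteq> perp {right C}"
      using at_candidate[OF h(1)] by (simp add: candidate_def)
    moreover have "at h C \<subseteq> at x C" if "x \<in> X" for x
      using h(2) that by (simp add: at_mono)
    ultimately show "at h C \<subseteq> meet C ((\<lambda>x. at x C) ` X)"
      by (simp add: meet_def le_INF_iff)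
  qed
qed

lemma tt_greatest:
  assumes "a \<in> truth_values"
  shows "a \<subseteq> family (\<lambda>C. meet C {})"
  by (rule truth_value_subsetI[OF assms]) (use at_candidate[OF assms] in \<open>simp add: meet_def candidate_def\<close>)

lemma alg_full_ordered_complete: "full_ordered_complete_pha alg"
proof
  fix a
  assume "a \<in> carrier alg" "sq alg (tt alg) a"
  then show "a = tt alg"
    using tt_greatest[of a] by (simp add: alg_def)
qed (simp_all add: alg_def tt_truth_value ff_truth_value con_truth_value imp_truth_value
    dis_truth_value all_truth_value ex_truth_value alg_complete family_mono at_mono
    con_facts_mono dis_facts_mono imp_facts_mono all_facts_mono ex_facts_mono)

end


section \<open>Soundness of the full calculus\<close>

lemma den_tm_subst: "den_tm M \<phi> (subst_tm \<sigma> t) = den_tm M (\<lambda>x. den_tm M \<phi> (\<sigma> x)) t"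
proof (induction t)
  case (Fn f ts)
  then show ?case by (simp cong: map_cong)
qed simp

lemma den_subst: "den B M \<phi> (subst_fm \<sigma> A) = den B M (\<lambda>x. den_tm M \<phi> (\<sigma> x)) A"
proof (induction A arbitrary: \<sigma> \<phi>)
  case (Pred p ts)
  then show ?case by (simp add: den_tm_subst cong: map_cong)
next
  case (Forall A)
  have "(\<lambda>x. den_tm M (case_nat e \<phi>) (up \<sigma> x)) = case_nat e (\<lambda>x. den_tm M \<phi> (\<sigma> x))" for e
    by (rule ext) (simp add: up_def den_tm_subst split: nat.split)
  then show ?case by (simp add: Forall)
next
  case (Exists A)
  have "(\<lambda>x. den_tm M (case_nat e \<phi>) (up \<sigma> x)) = case_nat e (\<lambda>x. den_tm M \<phi> (\<sigma> x))" for e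
    by (rule ext) (simp add: up_def den_tm_subst split: nat.split)
  then show ?case by (simp add: Exists)
qed simp_all

lemma den_inst: "den B M \<phi> (inst A t) = den B M (case_nat (den_tm M \<phi> t) \<phi>) A"
proof -
  have "(\<lambda>x. den_tm M \<phi> (case_nat t Var x)) = case_nat (den_tm M \<phi> t) \<phi>"
    by (rule ext) (simp split: nat.split)
  then show ?thesis by (simp add: inst_def den_subst)
qed

lemma den_lift: "den B M (case_nat e \<phi>) (lift A) = den B M \<phi> A"
  by (simp add: lift_def den_subst)

lemma range_case_nat: "e \<in> D \<Longrightarrow> range \<phi> \<subseteq> D \<Longrightarrow> range (case_nat e \<phi>) \<subseteq> D"
  by (auto simp: image_subset_iff split: nat.split)

lemma den_tm_domain:
  assumes "valued_structure L B M" "range \<phi> \<subseteq> domain M" "wf_tm L t"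
  shows "den_tm M \<phi> t \<in> domain M"
  using assms(3)
proof (induction t)
  case (Var x)
  then show ?case using assms(2) by auto
next
  case (Fn f ts)
  then have "set (map (den_tm M \<phi>) ts) \<subseteq> domain M" "(f, length ts) \<in> funs L"
    by auto
  then show ?case
    using assms(1) by (fastforce simp: valued_structure_def)
qed

lemma den_carrier:
  assumes "full_pha B" "valued_structure L B M"
  shows "range \<phi> \<subseteq> domain M \<Longrightarrow> wf_fm L A \<Longrightarrow> den B M \<phi> A \<in> carrier B"
proof (induction A arbitrary: \<phi>)
  case (Pred p ts)
  then have "set (map (den_tm M \<phi>) ts) \<subseteq> domain M" "(p, length ts) \<in> preds L"
    using den_tm_domain[OF assms(2)] by auto
  then show ?case
    using assms(2) by (fastforce simp: valued_structure_def)
next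
  case (Forall A)
  interpret full_pha B by fact
  have "(\<lambda>e. den B M (case_nat e \<phi>) A) ` domain M \<subseteq> carrier B"
    using Forall range_case_nat[OF _ Forall.prems(1)] by auto
  then show ?case by (simp add: all_closed all_full)
next
  case (Exists A)
  interpret full_pha B by fact
  have "(\<lambda>e. den B M (case_nat e \<phi>) A) ` domain M \<subseteq> carrier B"
    using Exists range_case_nat[OF _ Exists.prems(1)] by auto
  then show ?case by (simp add: ex_closed ex_full)
qed (use assms(1) in \<open>auto simp: full_pha_def pseudo_heyting_algebra_def\<close>)

locale algebra_model = rewrite_system L R
  for L :: "('f, 'p) language" and R :: "('f, 'p) rule set" +
  fixes M :: "('f, 'p, 'm, ('f, 'p) truth_value) struct"
  assumes model: "model L R alg M"
begin

abbreviation substs :: "(nat \<Rightarrow> 'f tm) set" where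
  "substs \<equiv> {\<sigma>. \<forall>x. wf_tm L (\<sigma> x)}"

abbreviation assignments :: "(nat \<Rightarrow> 'm) set" where
  "assignments \<equiv> {\<phi>. range \<phi> \<subseteq> domain M}"

text \<open>
  Terms and elements of \<open>M\<close> are paired: this is the structure with domain terms times \<open>domain M\<close>
  and values in the Boolean algebra of facts.
\<close>

definition val :: "(nat \<Rightarrow> 'f tm) \<Rightarrow> (nat \<Rightarrow> 'm) \<Rightarrow> ('f, 'p) fm \<Rightarrow> ('f, 'p) sequent set" where
  "val \<sigma> \<phi> A = at (den alg M \<phi> A) (subst_fm \<sigma> A)"

lemma valued_structure_M: "valued_structure L alg M"
  using model by (simp add: model_def)

lemma den_truth_value: "\<phi> \<in> assignments \<Longrightarrow> wf_fm L A \<Longrightarrow> den alg M \<phi> A \<in> truth_values"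
  using den_carrier[of alg L M \<phi> A] valued_structure_M alg_full_ordered_complete
  by (simp add: full_ordered_complete_pha_def full_ordered_pha_def alg_ops)

lemma subst_up_wf: "\<sigma> \<in> substs \<Longrightarrow> wf_fm L A \<Longrightarrow> wf_fm L (subst_fm (up \<sigma>) A)"
  by (simp add: wf_subst_fm wf_up)

lemma case_nat_substs: "\<sigma> \<in> substs \<Longrightarrow> wf_tm L t \<Longrightarrow> case_nat t \<sigma> \<in> substs"
  by (simp add: wf_case_nat)

lemma case_nat_assignments: "\<phi> \<in> assignments \<Longrightarrow> e \<in> domain M \<Longrightarrow> case_nat e \<phi> \<in> assignments"
  using range_case_nat[of e "domain M" \<phi>] by simp

lemma val_candidate:
  "\<sigma> \<in> substs \<Longrightarrow> \<phi> \<in> assignments \<Longrightarrow> wf_fm L A \<Longrightarrow> candidate (subst_fm \<sigma> A) (val \<sigma> \<phi> A)"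
  unfolding val_def by (simp add: at_candidate den_truth_value wf_subst_fm)

lemma val_fact: "\<sigma> \<in> substs \<Longrightarrow> \<phi> \<in> assignments \<Longrightarrow> wf_fm L A \<Longrightarrow> fact (val \<sigma> \<phi> A)"
  by (rule candidate_fact[OF val_candidate])

text \<open>Two invariances combine: the model equates the denotations of \<open>A\<close> and
  \<open>B\<close>, and invariance of a truth value moves the index from
  \<open>subst_fm \<sigma> A\<close> to \<open>subst_fm \<sigma> B\<close>.\<close>

lemma val_cong:
  assumes "\<sigma> \<in> substs" "\<phi> \<in> assignments" "A \<cong> B"
  shows "val \<sigma> \<phi> A = val \<sigma> \<phi> B"
proof -
  have "den alg M \<phi> A = den alg M \<phi> B"
    using model assms by (auto simp: model_def)
  moreover have "at (den alg M \<phi> B) (subst_fm \<sigma> A) = at (den alg M \<phi> B) (subst_fm \<sigma> B)"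
    using assms cong_wf[OF assms(3)] by (intro at_cong den_truth_value cong_subst) auto
  ultimately show ?thesis by (simp add: val_def)
qed

lemma val_lift: "val (case_nat t \<sigma>) (case_nat e \<phi>) (lift A) = val \<sigma> \<phi> A"
  by (simp add: val_def den_lift subst_case_nat_lift)

lemma val_inst: "val \<sigma> \<phi> (inst A t) = val (case_nat (subst_tm \<sigma> t) \<sigma>) (case_nat (den_tm M \<phi> t) \<phi>) A"
  by (simp add: val_def den_inst subst_inst)

section \<open>Values of compound propositions\<close>

lemma val_Truth: "\<sigma> \<in> substs \<Longrightarrow> seqs \<subseteq> val \<sigma> \<phi> Truth"
  unfolding val_def by (auto simp: alg_ops at_family meet_def provable_TruthR intro: perpI)

lemma val_Falsity: "seqs \<subseteq> perp (val \<sigma> \<phi> Falsity)"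
proof -
  have "val \<sigma> \<phi> Falsity = perp (perp {left Falsity})"
    by (simp add: val_def alg_ops at_family join_def)
  moreover have "seqs \<subseteq> perp {left Falsity}"
    by (auto simp: provable_FalsityL intro: perpI)
  ultimately show ?thesis
    by (simp add: perp_perp_perp left_seqs)
qed

text \<open>Injectivity modulo the congruence collapses the collected decompositions to the two
  components, and \<open>conjR\<close> shows that the clip in \<open>meet\<close> removes
  nothing.\<close>

lemma val_Conj:
  assumes "\<sigma> \<in> substs" "\<phi> \<in> assignments" "wf_fm L (Conj A B)"
  shows "val \<sigma> \<phi> (Conj A B) = val \<sigma> \<phi> A \<inter> val \<sigma> \<phi> B"
proof -
  let ?a = "den alg M \<phi> A" and ?b = "den alg M \<phi> B"
  let ?A = "subst_fm \<sigma> A" and ?B = "subst_fm \<sigma> B"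
  have wf: "wf_fm L ?A" "wf_fm L ?B"
    using assms by (auto intro: wf_subst_fm)
  have tv: "?a \<in> truth_values" "?b \<in> truth_values"
    using assms by (auto intro: den_truth_value)
  have "con_facts ?a ?b (Conj ?A ?B) = {at ?a ?A, at ?b ?B}"
  proof (intro subset_antisym subsetI)
    fix F
    assume "F \<in> con_facts ?a ?b (Conj ?A ?B)"
    then obtain A' B' where "?A \<cong> A'" "?B \<cong> B'" "F = at ?a A' \<or> F = at ?b B'"
      unfolding con_facts_def using cong_Conj_inj by blast
    then show "F \<in> {at ?a ?A, at ?b ?B}"
      using at_cong[OF tv(1)] at_cong[OF tv(2)] by blast
  next
    fix F
    assume "F \<in> {at ?a ?A, at ?b ?B}"
    then show "F \<in> con_facts ?a ?b (Conj ?A ?B)"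
      using wf cong_refl[of L "Conj ?A ?B" R] by (auto simp: con_facts_def)
  qed
  then have "val \<sigma> \<phi> (Conj A B) = perp {right (Conj ?A ?B)} \<inter> (val \<sigma> \<phi> A \<inter> val \<sigma> \<phi> B)"
    using wf by (simp add: val_def alg_ops at_family meet_def)
  moreover have "s \<in> perp {right (Conj ?A ?B)}" if "s \<in> val \<sigma> \<phi> A" "s \<in> val \<sigma> \<phi> B" for s
  proof -
    have cand: "candidate ?A (val \<sigma> \<phi> A)" "candidate ?B (val \<sigma> \<phi> B)"
      using assms by (auto intro: val_candidate)
    have "s + right (Conj ?A ?B) \<in> provable"
      using wf by (intro provable_conjR[OF candidate_right[OF cand(1)] candidate_right[OF cand(2)]] that cong_refl) simp
    then show ?thesis
      using fact_seqs[OF candidate_fact[OF cand(1)] that(1)] by (simp add: perp_def)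
  qed
  ultimately show ?thesis by blast
qed

lemma val_Impl:
  assumes "\<sigma> \<in> substs" "\<phi> \<in> assignments" "wf_fm L (Impl A B)"
  shows "val \<sigma> \<phi> (Impl A B) = {s \<in> seqs. \<forall>u\<in>val \<sigma> \<phi> A. s + u \<in> val \<sigma> \<phi> B}"
proof -
  let ?a = "den alg M \<phi> A" and ?b = "den alg M \<phi> B"
  let ?A = "subst_fm \<sigma> A" and ?B = "subst_fm \<sigma> B"
  have wf: "wf_fm L ?A" "wf_fm L ?B"
    using assms by (auto intro: wf_subst_fm)
  have tv: "?a \<in> truth_values" "?b \<in> truth_values"
    using assms by (auto intro: den_truth_value)
  have "imp_facts ?a ?b (Impl ?A ?B) = (\<lambda>u. {s \<in> seqs. s + u \<in> at ?b ?B}) ` at ?a ?A"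
  proof (intro subset_antisym subsetI)
    fix F
    assume "F \<in> imp_facts ?a ?b (Impl ?A ?B)"
    then obtain A' B' u where "?A \<cong> A'" "?B \<cong> B'" "u \<in> at ?a A'" "F = {s \<in> seqs. s + u \<in> at ?b B'}"
      unfolding imp_facts_def using cong_Impl_inj by blast
    then show "F \<in> (\<lambda>u. {s \<in> seqs. s + u \<in> at ?b ?B}) ` at ?a ?A"
      using at_cong[OF tv(1)] at_cong[OF tv(2)] by blast
  next
    fix F
    assume "F \<in> (\<lambda>u. {s \<in> seqs. s + u \<in> at ?b ?B}) ` at ?a ?A"
    then show "F \<in> imp_facts ?a ?b (Impl ?A ?B)"
      using wf cong_refl[of L "Impl ?A ?B" R] unfolding imp_facts_def by fastforce
  qed
  then have "val \<sigma> \<phi> (Impl A B) =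
      perp {right (Impl ?A ?B)} \<inter> (\<Inter>u\<in>val \<sigma> \<phi> A. {s \<in> seqs. s + u \<in> val \<sigma> \<phi> B})"
    using wf by (simp add: val_def alg_ops at_family meet_def)
  moreover have "s \<in> perp {right (Impl ?A ?B)}"
    if "s \<in> seqs" and s: "\<forall>u\<in>val \<sigma> \<phi> A. s + u \<in> val \<sigma> \<phi> B" for s
  proof -
    have cand: "candidate ?A (val \<sigma> \<phi> A)" "candidate ?B (val \<sigma> \<phi> B)"
      using assms by (auto intro: val_candidate)
    \<comment> \<open>The candidate condition puts \<open>left ?A\<close> into the value of
      \<open>A\<close>; choosing it for \<open>u\<close> yields the premise of
      \<open>implR\<close>.\<close>
    have "s + left ?A \<in> val \<sigma> \<phi> B"
      using s cand(1) by (simp add: candidate_def)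
    then have "s + right (Impl ?A ?B) \<in> provable"
      by (rule provable_implR[OF candidate_right[OF cand(2)] cong_refl]) (simp add: wf)
    then show ?thesis
      using that(1) by (simp add: perp_def)
  qed
  ultimately show ?thesis
    using perp_seqs by blast
qed

lemma perp_join:
  assumes "insert (left C) X \<subseteq> seqs"
  shows "perp (perp (perp (insert (left C) X))) = perp {left C} \<inter> perp X"
  unfolding perp_perp_perp[OF assms] by (rule perp_insert)

text \<open>Stated for orthogonals because a join is a double closure, which \<open>perp\<close>
  does not see; a member of the value itself need not belong to the value of either
  component.\<close>

lemma perp_val_Disj:
  assumes "\<sigma> \<in> substs" "\<phi> \<in> assignments" "wf_fm L (Disj A B)"
  shows "perp (val \<sigma> \<phi> (Disj A B)) = perp (val \<sigma> \<phi> A) \<inter> perp (val \<sigma> \<phi> B)"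
proof -
  let ?a = "den alg M \<phi> A" and ?b = "den alg M \<phi> B"
  let ?A = "subst_fm \<sigma> A" and ?B = "subst_fm \<sigma> B"
  have wf: "wf_fm L ?A" "wf_fm L ?B"
    using assms by (auto intro: wf_subst_fm)
  have tv: "?a \<in> truth_values" "?b \<in> truth_values"
    using assms by (auto intro: den_truth_value)
  have cand: "candidate ?A (val \<sigma> \<phi> A)" "candidate ?B (val \<sigma> \<phi> B)"
    using assms by (auto intro: val_candidate)
  have "dis_facts ?a ?b (Disj ?A ?B) = {at ?a ?A, at ?b ?B}"
  proof (intro subset_antisym subsetI)
    fix F
    assume "F \<in> dis_facts ?a ?b (Disj ?A ?B)"
    then obtain A' B' where "?A \<cong> A'" "?B \<cong> B'" "F = at ?a A' \<or> F = at ?b B'"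
      unfolding dis_facts_def using cong_Disj_inj by blast
    then show "F \<in> {at ?a ?A, at ?b ?B}"
      using at_cong[OF tv(1)] at_cong[OF tv(2)] by blast
  next
    fix F
    assume "F \<in> {at ?a ?A, at ?b ?B}"
    then show "F \<in> dis_facts ?a ?b (Disj ?A ?B)"
      using wf cong_refl[of L "Disj ?A ?B" R] by (auto simp: dis_facts_def)
  qed
  then have "val \<sigma> \<phi> (Disj A B) = perp (perp (insert (left (Disj ?A ?B)) (val \<sigma> \<phi> A \<union> val \<sigma> \<phi> B)))"
    using wf by (simp add: val_def alg_ops at_family join_def)
  moreover have "insert (left (Disj ?A ?B)) (val \<sigma> \<phi> A \<union> val \<sigma> \<phi> B) \<subseteq> seqs"
    using cand fact_seqs wf by (auto simp: left_seqs candidate_def)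
  ultimately have "perp (val \<sigma> \<phi> (Disj A B)) =
      perp {left (Disj ?A ?B)} \<inter> perp (val \<sigma> \<phi> A \<union> val \<sigma> \<phi> B)"
    by (simp only: perp_join)
  moreover have "perp (val \<sigma> \<phi> A \<union> val \<sigma> \<phi> B) = perp (val \<sigma> \<phi> A) \<inter> perp (val \<sigma> \<phi> B)"
    by (auto simp: perp_def)
  moreover have "u \<in> perp {left (Disj ?A ?B)}"
    if "u \<in> perp (val \<sigma> \<phi> A)" "u \<in> perp (val \<sigma> \<phi> B)" for u
  proof -
    have "u + left (Disj ?A ?B) \<in> provable"
      using wf by (intro provable_disjL[OF candidate_left[OF cand(1)] candidate_left[OF cand(2)]] that cong_refl) simp
    then show ?thesis
      using that perp_seqs by (auto simp: perp_def)
  qed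
  ultimately show ?thesis by blast
qed

text \<open>Every term meets every domain element because \<open>all_facts\<close> combines them
  independently. Having all instances is what \<open>provable_allR\<close> needs to absorb the
  clip.\<close>

lemma val_Forall:
  assumes "\<sigma> \<in> substs" "\<phi> \<in> assignments" "wf_fm L (Forall A)"
  shows "val \<sigma> \<phi> (Forall A) =
    (\<Inter>t\<in>{t. wf_tm L t}. \<Inter>e\<in>domain M. val (case_nat t \<sigma>) (case_nat e \<phi>) A)"
proof -
  let ?a = "\<lambda>e. den alg M (case_nat e \<phi>) A" and ?A = "subst_fm (up \<sigma>) A"
  have wf: "wf_fm L ?A"
    using assms by (auto intro: subst_up_wf)
  have tv: "?a e \<in> truth_values" if "e \<in> domain M" for e
    using assms case_nat_assignments[OF assms(2) that] by (auto intro: den_truth_value)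
  have "all_facts (?a ` domain M) (Forall ?A) =
      (\<Union>t\<in>{t. wf_tm L t}. (\<lambda>e. at (?a e) (inst ?A t)) ` domain M)"
  proof (intro subset_antisym subsetI)
    fix F
    assume "F \<in> all_facts (?a ` domain M) (Forall ?A)"
    then obtain A' t e where *: "?A \<cong> A'" "wf_tm L t" "e \<in> domain M" "F = at (?a e) (inst A' t)"
      unfolding all_facts_def using cong_Forall_inj by blast
    then have "F = at (?a e) (inst ?A t)"
      using at_cong[OF tv[OF *(3)] cong_inst[OF *(1,2)]] by simp
    then show "F \<in> (\<Union>t\<in>{t. wf_tm L t}. (\<lambda>e. at (?a e) (inst ?A t)) ` domain M)"
      using * by blast
  next
    fix F
    assume "F \<in> (\<Union>t\<in>{t. wf_tm L t}. (\<lambda>e. at (?a e) (inst ?A t)) ` domain M)"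
    then obtain t e where "wf_tm L t" "e \<in> domain M" "F = at (?a e) (inst ?A t)" by blast
    moreover have "Forall ?A \<cong> Forall ?A"
      using wf by (simp add: cong_refl)
    ultimately show "F \<in> all_facts (?a ` domain M) (Forall ?A)"
      unfolding all_facts_def by blast
  qed
  then have "\<Inter>(all_facts (?a ` domain M) (Forall ?A)) =
      (\<Inter>t\<in>{t. wf_tm L t}. \<Inter>e\<in>domain M. at (?a e) (inst ?A t))"
    by auto
  then have eq: "val \<sigma> \<phi> (Forall A) = perp {right (Forall ?A)} \<inter>
      (\<Inter>t\<in>{t. wf_tm L t}. \<Inter>e\<in>domain M. val (case_nat t \<sigma>) (case_nat e \<phi>) A)"
    using wf by (simp add: val_def alg_ops at_family meet_def subst_case_nat)
  have "s \<in> perp {right (Forall ?A)}"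
    if s: "\<And>t e. wf_tm L t \<Longrightarrow> e \<in> domain M \<Longrightarrow> s \<in> val (case_nat t \<sigma>) (case_nat e \<phi>) A" for s
  proof -
    \<comment> \<open>Any one domain element will do: together with each \<open>t\<close> it gives a
      candidate for \<open>inst ?A t\<close>.\<close>
    obtain e where e: "e \<in> domain M"
      using valued_structure_M by (auto simp: valued_structure_def)
    have "s + right (inst ?A t) \<in> provable" if "wf_tm L t" for t
    proof -
      have "candidate (inst ?A t) (val (case_nat t \<sigma>) (case_nat e \<phi>) A)"
        using val_candidate[OF case_nat_substs case_nat_assignments, of \<sigma> t \<phi> e A] assms e that
        by (simp add: subst_case_nat)
      then show ?thesis
        using s that e by (blast intro: candidate_right)
    qed
    then have "s + right (Forall ?A) \<in> provable"
      using wf provable_allR[OF _ cong_refl[of L "Forall ?A" R]] by simp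
    moreover from this have "s \<in> seqs"
      using provable_seqs seqs_add by blast
    ultimately show ?thesis
      by (simp add: perp_def)
  qed
  then show ?thesis
    unfolding eq by blast
qed

lemma perp_val_Exists:
  assumes "\<sigma> \<in> substs" "\<phi> \<in> assignments" "wf_fm L (Exists A)"
  shows "perp (val \<sigma> \<phi> (Exists A)) =
    (\<Inter>t\<in>{t. wf_tm L t}. \<Inter>e\<in>domain M. perp (val (case_nat t \<sigma>) (case_nat e \<phi>) A))"
proof -
  let ?a = "\<lambda>e. den alg M (case_nat e \<phi>) A" and ?A = "subst_fm (up \<sigma>) A"
  let ?U = "\<Union>t\<in>{t. wf_tm L t}. \<Union>e\<in>domain M. val (case_nat t \<sigma>) (case_nat e \<phi>) A"
  obtain d where d: "d \<in> domain M"
    using valued_structure_M by (auto simp: valued_structure_def)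
  have wf: "wf_fm L ?A"
    using assms by (auto intro: subst_up_wf)
  have tv: "?a e \<in> truth_values" if "e \<in> domain M" for e
    using assms case_nat_assignments[OF assms(2) that] by (auto intro: den_truth_value)
  have cand: "candidate (inst ?A t) (val (case_nat t \<sigma>) (case_nat e \<phi>) A)"
    if "wf_tm L t" "e \<in> domain M" for t e
    using val_candidate[OF case_nat_substs case_nat_assignments, of \<sigma> t \<phi> e A] assms that
    by (simp add: subst_case_nat)
  have "ex_facts (?a ` domain M) (Exists ?A) =
      (\<Union>t\<in>{t. wf_tm L t}. (\<lambda>e. at (?a e) (inst ?A t)) ` domain M)"
  proof (intro subset_antisym subsetI)
    fix F
    assume "F \<in> ex_facts (?a ` domain M) (Exists ?A)"
    then obtain A' t e where *: "?A \<cong> A'" "wf_tm L t" "e \<in> domain M" "F = at (?a e) (inst A' t)"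
      unfolding ex_facts_def using cong_Exists_inj by blast
    then have "F = at (?a e) (inst ?A t)"
      using at_cong[OF tv[OF *(3)] cong_inst[OF *(1,2)]] by simp
    then show "F \<in> (\<Union>t\<in>{t. wf_tm L t}. (\<lambda>e. at (?a e) (inst ?A t)) ` domain M)"
      using * by blast
  next
    fix F
    assume "F \<in> (\<Union>t\<in>{t. wf_tm L t}. (\<lambda>e. at (?a e) (inst ?A t)) ` domain M)"
    then obtain t e where "wf_tm L t" "e \<in> domain M" "F = at (?a e) (inst ?A t)" by blast
    moreover have "Exists ?A \<cong> Exists ?A"
      using wf by (simp add: cong_refl)
    ultimately show "F \<in> ex_facts (?a ` domain M) (Exists ?A)"
      unfolding ex_facts_def by blast
  qed
  then have "\<Union>(ex_facts (?a ` domain M) (Exists ?A)) =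
      (\<Union>t\<in>{t. wf_tm L t}. \<Union>e\<in>domain M. at (?a e) (inst ?A t))"
    by auto
  then have "val \<sigma> \<phi> (Exists A) = perp (perp (insert (left (Exists ?A)) ?U))"
    using wf by (simp add: val_def alg_ops at_family join_def subst_case_nat)
  moreover have "insert (left (Exists ?A)) ?U \<subseteq> seqs"
    using fact_seqs[OF candidate_fact[OF cand]] wf left_seqs[of "Exists ?A"]
    by (intro insert_subsetI UN_least subsetI) auto
  ultimately have eq: "perp (val \<sigma> \<phi> (Exists A)) = perp {left (Exists ?A)} \<inter> perp ?U"
    by (simp only: perp_join)
  \<comment> \<open>Both index sets are inhabited, by \<open>d\<close> and by the variables; over an
    empty one the intersection would be everything instead of \<open>seqs\<close>.\<close>
  have U: "perp ?U =
      (\<Inter>t\<in>{t. wf_tm L t}. \<Inter>e\<in>domain M. perp (val (case_nat t \<sigma>) (case_nat e \<phi>) A))" (is "_ = ?I")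
    using d wf_tm.simps(1)[of L] unfolding perp_def by blast
  have "?I \<subseteq> perp {left (Exists ?A)}"
  proof
    fix u
    assume u: "u \<in> ?I"
    have "u + left (inst ?A t) \<in> provable" if "wf_tm L t" for t
      using candidate_left[OF cand[OF that d]] that d u by blast
    then have "u + left (Exists ?A) \<in> provable"
      using wf provable_exL[OF _ cong_refl[of L "Exists ?A" R]] by simp
    moreover from this have "u \<in> seqs"
      using provable_seqs seqs_add by blast
    ultimately show "u \<in> perp {left (Exists ?A)}"
      by (simp add: perp_def)
  qed
  then show ?thesis
    unfolding eq U by (rule Int_absorb1)
qed

text \<open>Inclusion of this set in \<open>provable\<close> is the Boolean inequality from the meet
  of \<open>\<Gamma>\<close> to the join of \<open>\<Delta>\<close>, written as disjointness up to
  the least fact. One and the same \<open>u\<close> serves all formulas.\<close>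

definition sat :: "(nat \<Rightarrow> 'f tm) \<Rightarrow> (nat \<Rightarrow> 'm) \<Rightarrow> ('f, 'p) fm multiset \<Rightarrow> ('f, 'p) fm multiset \<Rightarrow> ('f, 'p) sequent set"
  where "sat \<sigma> \<phi> \<Gamma> \<Delta> =
    {u \<in> seqs. (\<forall>A\<in>#\<Gamma>. u \<in> val \<sigma> \<phi> A) \<and> (\<forall>A\<in>#\<Delta>. u \<in> perp (val \<sigma> \<phi> A))}"

lemma sat_weaken:
  assumes "\<sigma> \<in> substs" "\<phi> \<in> assignments" "\<forall>A\<in>#\<Gamma>. wf_fm L A" "u \<in> sat \<sigma> \<phi> \<Gamma> \<Delta>" "v \<in> seqs"
  shows "u + v \<in> sat \<sigma> \<phi> \<Gamma> \<Delta>"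
  using assms(3-5) fact_weaken[OF val_fact[OF assms(1,2)]] perp_weaken
  unfolding sat_def by (simp add: seqs_add)

text \<open>For \<open>v\<close> orthogonal to the value of \<open>A\<close>, weakening makes
  \<open>u + v\<close> satisfy the context and refute \<open>A\<close>, so the hypothesis applies;
  double orthogonality then gives membership. This passage is what makes cut sound.\<close>

lemma sat_right:
  assumes "\<sigma> \<in> substs" "\<phi> \<in> assignments" "sat \<sigma> \<phi> \<Gamma> (add_mset A \<Delta>) \<subseteq> provable" "u \<in> sat \<sigma> \<phi> \<Gamma> \<Delta>"
    and wf: "\<forall>A\<in>#\<Gamma>. wf_fm L A" "wf_fm L A"
  shows "u \<in> val \<sigma> \<phi> A"
proof (rule fact_memI[OF val_fact[OF assms(1,2) wf(2)]])
  show "u \<in> seqs"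
    using assms(4) by (simp add: sat_def)
  fix v
  assume v: "v \<in> perp (val \<sigma> \<phi> A)"
  then have vseq: "v \<in> seqs"
    using perp_seqs by blast
  have "v + u \<in> perp (val \<sigma> \<phi> A)"
    by (rule perp_weaken[OF v \<open>u \<in> seqs\<close>])
  then have "u + v \<in> sat \<sigma> \<phi> \<Gamma> (add_mset A \<Delta>)"
    using sat_weaken[OF assms(1,2) wf(1) assms(4) vseq] by (simp add: sat_def add.commute)
  then show "u + v \<in> provable"
    using assms(3) by blast
qed

lemma sat_left:
  assumes "\<sigma> \<in> substs" "\<phi> \<in> assignments" "sat \<sigma> \<phi> (add_mset A \<Gamma>) \<Delta> \<subseteq> provable" "u \<in> sat \<sigma> \<phi> \<Gamma> \<Delta>"
    and wf: "\<forall>A\<in>#\<Gamma>. wf_fm L A" "wf_fm L A"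
  shows "u \<in> perp (val \<sigma> \<phi> A)"
proof (rule perpI)
  show "u \<in> seqs"
    using assms(4) by (simp add: sat_def)
  fix v
  assume v: "v \<in> val \<sigma> \<phi> A"
  then have vseq: "v \<in> seqs"
    by (rule fact_seqs[OF val_fact[OF assms(1,2) wf(2)]])
  have "v + u \<in> val \<sigma> \<phi> A"
    by (rule fact_weaken[OF val_fact[OF assms(1,2) wf(2)] v \<open>u \<in> seqs\<close>])
  then have "u + v \<in> sat \<sigma> \<phi> (add_mset A \<Gamma>) \<Delta>"
    using sat_weaken[OF assms(1,2) wf(1) assms(4) vseq] by (simp add: sat_def add.commute)
  then show "u + v \<in> provable"
    using assms(3) by blast
qed

text \<open>Orthogonality only makes \<open>u + u\<close> provable; contraction does the
  rest.\<close>

lemma provable_if_both: "u \<in> F \<Longrightarrow> u \<in> perp F \<Longrightarrow> u \<in> provable"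
  using perpD provable_contract by blast

lemma sat_lift:
  "sat (case_nat t \<sigma>) (case_nat e \<phi>) (image_mset lift \<Gamma>) (image_mset lift \<Delta>) = sat \<sigma> \<phi> \<Gamma> \<Delta>"
  by (simp add: sat_def val_lift)

lemma sat_add_left: "u \<in> sat \<sigma> \<phi> (add_mset A \<Gamma>) \<Delta> \<longleftrightarrow> u \<in> val \<sigma> \<phi> A \<and> u \<in> sat \<sigma> \<phi> \<Gamma> \<Delta>"
  by (auto simp: sat_def)

lemma sat_add_right: "u \<in> sat \<sigma> \<phi> \<Gamma> (add_mset A \<Delta>) \<longleftrightarrow> u \<in> perp (val \<sigma> \<phi> A) \<and> u \<in> sat \<sigma> \<phi> \<Gamma> \<Delta>"
  by (auto simp: sat_def)

text \<open>Both environments are generalised in the induction because \<open>allR\<close> and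
  \<open>exL\<close> extend them, one by a term and the other by a domain element.\<close>

lemma soundness:
  "LK True L R \<Gamma> \<Delta> \<Longrightarrow> \<sigma> \<in> substs \<Longrightarrow> \<phi> \<in> assignments \<Longrightarrow> sat \<sigma> \<phi> \<Gamma> \<Delta> \<subseteq> provable"
proof (induction arbitrary: \<sigma> \<phi> rule: LK.induct)
  case (ax A B)
  show ?case
    using val_cong[OF ax(2,3,1)] provable_if_both by (auto simp: sat_add_left sat_add_right)
next
  case (cut \<Gamma> A \<Delta> B)
  note IH = cut.IH(1)[OF cut.prems] cut.IH(2)[OF cut.prems]
  have wf: "\<forall>A\<in>#\<Gamma>. wf_fm L A" "wf_fm L A"
    using LK_wf[OF cut.hyps(2)] by auto
  show ?case
  proof
    fix u
    assume u: "u \<in> sat \<sigma> \<phi> \<Gamma> \<Delta>"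
    \<comment> \<open>The first premise puts \<open>u\<close> into the value of \<open>A\<close>,
      which is the value of \<open>B\<close>, so the second premise applies to the same
      \<open>u\<close>.\<close>
    have "u \<in> val \<sigma> \<phi> A"
      by (rule sat_right[OF cut.prems IH(1) u wf])
    then have "u \<in> sat \<sigma> \<phi> (add_mset B \<Gamma>) \<Delta>"
      using u val_cong[OF cut.prems cut.hyps(4)] by (simp add: sat_add_left)
    then show "u \<in> provable"
      using IH(2) by blast
  qed
next
  case (weakL \<Gamma> \<Delta> C)
  show ?case
    using weakL.IH[OF weakL.prems] by (auto simp: sat_add_left)
next
  case (weakR \<Gamma> \<Delta> C)
  show ?case
    using weakR.IH[OF weakR.prems] by (auto simp: sat_add_right)
next
  case (contrL A B \<Gamma> \<Delta> C)
  show ?case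
    using contrL.IH[OF contrL.prems] val_cong[OF contrL.prems contrL.hyps(2)]
      val_cong[OF contrL.prems contrL.hyps(3)]
    by (auto simp: sat_add_left)
next
  case (contrR \<Gamma> A B \<Delta> C)
  show ?case
    using contrR.IH[OF contrR.prems] val_cong[OF contrR.prems contrR.hyps(2)]
      val_cong[OF contrR.prems contrR.hyps(3)]
    by (auto simp: sat_add_right)
next
  case (topR C \<Gamma> \<Delta>)
  show ?case
  proof
    fix u
    assume "u \<in> sat \<sigma> \<phi> \<Gamma> (add_mset C \<Delta>)"
    then have "u \<in> perp (val \<sigma> \<phi> Truth)" "u \<in> seqs"
      using val_cong[OF topR.prems topR.hyps(1)] by (simp_all add: sat_def)
    then show "u \<in> provable"
      using val_Truth[OF topR.prems(1)] provable_if_both by blast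
  qed
next
  case (botL C \<Gamma> \<Delta>)
  show ?case
  proof
    fix u
    assume "u \<in> sat \<sigma> \<phi> (add_mset C \<Gamma>) \<Delta>"
    then have "u \<in> val \<sigma> \<phi> Falsity" "u \<in> seqs"
      using val_cong[OF botL.prems botL.hyps(1)] by (simp_all add: sat_def)
    then show "u \<in> provable"
      using val_Falsity provable_if_both by blast
  qed
next
  case (conjL A B \<Gamma> \<Delta> C)
  have "val \<sigma> \<phi> C = val \<sigma> \<phi> A \<inter> val \<sigma> \<phi> B"
    using val_cong[OF conjL.prems conjL.hyps(2)] val_Conj[OF conjL.prems] cong_wf[OF conjL.hyps(2)] by simp
  then show ?case
    using conjL.IH[OF conjL.prems] by (auto simp: sat_add_left)
next
  case (conjR \<Gamma> A \<Delta> B C)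
  note IH = conjR.IH(1)[OF conjR.prems] conjR.IH(2)[OF conjR.prems]
  have wf: "\<forall>A\<in>#\<Gamma>. wf_fm L A" "wf_fm L A" "wf_fm L B"
    using LK_wf[OF conjR.hyps(1)] LK_wf[OF conjR.hyps(2)] by auto
  have C: "val \<sigma> \<phi> C = val \<sigma> \<phi> A \<inter> val \<sigma> \<phi> B"
    using val_cong[OF conjR.prems conjR.hyps(3)] val_Conj[OF conjR.prems] cong_wf[OF conjR.hyps(3)] by simp
  show ?case
  proof
    fix u
    assume u: "u \<in> sat \<sigma> \<phi> \<Gamma> (add_mset C \<Delta>)"
    then have u': "u \<in> sat \<sigma> \<phi> \<Gamma> \<Delta>"
      by (simp add: sat_add_right)
    have "u \<in> val \<sigma> \<phi> A" "u \<in> val \<sigma> \<phi> B"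
      using sat_right[OF conjR.prems IH(1) u' wf(1,2)] sat_right[OF conjR.prems IH(2) u' wf(1,3)] by auto
    then show "u \<in> provable"
      using u C provable_if_both[of u "val \<sigma> \<phi> C"] by (simp add: sat_add_right)
  qed
next
  case (disjL A \<Gamma> \<Delta> B C)
  note IH = disjL.IH(1)[OF disjL.prems] disjL.IH(2)[OF disjL.prems]
  have wf: "\<forall>A\<in>#\<Gamma>. wf_fm L A" "wf_fm L A" "wf_fm L B"
    using LK_wf[OF disjL.hyps(1)] LK_wf[OF disjL.hyps(2)] by auto
  have C: "perp (val \<sigma> \<phi> C) = perp (val \<sigma> \<phi> A) \<inter> perp (val \<sigma> \<phi> B)"
    using val_cong[OF disjL.prems disjL.hyps(3)] perp_val_Disj[OF disjL.prems] cong_wf[OF disjL.hyps(3)] by simp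
  show ?case
  proof
    fix u
    assume u: "u \<in> sat \<sigma> \<phi> (add_mset C \<Gamma>) \<Delta>"
    then have u': "u \<in> sat \<sigma> \<phi> \<Gamma> \<Delta>"
      by (simp add: sat_add_left)
    have "u \<in> perp (val \<sigma> \<phi> A)" "u \<in> perp (val \<sigma> \<phi> B)"
      using sat_left[OF disjL.prems IH(1) u' wf(1,2)] sat_left[OF disjL.prems IH(2) u' wf(1,3)] by auto
    then show "u \<in> provable"
      using u C provable_if_both[of u "val \<sigma> \<phi> C"] by (simp add: sat_add_left)
  qed
next
  case (disjR \<Gamma> A B \<Delta> C)
  have "perp (val \<sigma> \<phi> C) = perp (val \<sigma> \<phi> A) \<inter> perp (val \<sigma> \<phi> B)"
    using val_cong[OF disjR.prems disjR.hyps(2)] perp_val_Disj[OF disjR.prems] cong_wf[OF disjR.hyps(2)] by simp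
  then show ?case
    using disjR.IH[OF disjR.prems] by (auto simp: sat_add_right)
next
  case (implL \<Gamma> A \<Delta> B C)
  note IH = implL.IH(1)[OF implL.prems] implL.IH(2)[OF implL.prems]
  have wf: "\<forall>A\<in>#\<Gamma>. wf_fm L A" "wf_fm L A" "wf_fm L B"
    using LK_wf[OF implL.hyps(1)] LK_wf[OF implL.hyps(2)] by auto
  have C: "val \<sigma> \<phi> C = {s \<in> seqs. \<forall>u\<in>val \<sigma> \<phi> A. s + u \<in> val \<sigma> \<phi> B}"
    using val_cong[OF implL.prems implL.hyps(3)] val_Impl[OF implL.prems] cong_wf[OF implL.hyps(3)] by simp
  show ?case
  proof
    fix u
    assume u: "u \<in> sat \<sigma> \<phi> (add_mset C \<Gamma>) \<Delta>"
    then have u': "u \<in> sat \<sigma> \<phi> \<Gamma> \<Delta>"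
      by (simp add: sat_add_left)
    have "u \<in> val \<sigma> \<phi> A" "u \<in> perp (val \<sigma> \<phi> B)"
      using sat_right[OF implL.prems IH(1) u' wf(1,2)] sat_left[OF implL.prems IH(2) u' wf(1,3)] by auto
    \<comment> \<open>\<open>u\<close> serves as implication, as its argument and as refuter of
      \<open>B\<close>; the three resulting copies are then contracted.\<close>
    moreover from this have "u + u \<in> val \<sigma> \<phi> B"
      using u C by (simp add: sat_add_left)
    ultimately have "u + (u + u) \<in> provable"
      using perpD by blast
    then show "u \<in> provable"
      using provable_contract_add[of u u] provable_contract[of u] by (simp add: add.assoc)
  qed
next
  case (implR A \<Gamma> B \<Delta> C)
  note IH = implR.IH[OF implR.prems]
  have wf: "\<forall>A\<in>#\<Gamma>. wf_fm L A" "wf_fm L A" "wf_fm L B"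
    using LK_wf[OF implR.hyps(1)] by auto
  have C: "val \<sigma> \<phi> C = {s \<in> seqs. \<forall>u\<in>val \<sigma> \<phi> A. s + u \<in> val \<sigma> \<phi> B}"
    using val_cong[OF implR.prems implR.hyps(2)] val_Impl[OF implR.prems] cong_wf[OF implR.hyps(2)] by simp
  show ?case
  proof
    fix u
    assume u: "u \<in> sat \<sigma> \<phi> \<Gamma> (add_mset C \<Delta>)"
    then have u': "u \<in> sat \<sigma> \<phi> \<Gamma> \<Delta>" "u \<in> seqs"
      by (simp_all add: sat_def)
    have "u + v \<in> val \<sigma> \<phi> B" if v: "v \<in> val \<sigma> \<phi> A" for v
    proof (rule sat_right[OF implR.prems IH])
      have vseq: "v \<in> seqs"
        by (rule fact_seqs[OF val_fact[OF implR.prems wf(2)] v])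
      have "v + u \<in> val \<sigma> \<phi> A"
        by (rule fact_weaken[OF val_fact[OF implR.prems wf(2)] v u'(2)])
      then show "u + v \<in> sat \<sigma> \<phi> (add_mset A \<Gamma>) \<Delta>"
        using sat_weaken[OF implR.prems wf(1) u'(1) vseq] by (simp add: sat_add_left add.commute)
    qed (use wf in auto)
    then have "u \<in> val \<sigma> \<phi> C"
      using u' C by simp
    then show "u \<in> provable"
      using u provable_if_both[of u "val \<sigma> \<phi> C"] by (simp add: sat_add_right)
  qed
next
  case (allL A t \<Gamma> \<Delta> C)
  have wf: "wf_fm L (Forall A)"
    using cong_wf[OF allL.hyps(3)] by simp
  have "wf_tm L (subst_tm \<sigma> t)" "den_tm M \<phi> t \<in> domain M"
    using allL.prems allL.hyps(2) den_tm_domain[OF valued_structure_M] by (auto intro: wf_subst_tm)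
  then have "val \<sigma> \<phi> C \<subseteq> val \<sigma> \<phi> (inst A t)"
    unfolding val_cong[OF allL.prems allL.hyps(3)] val_Forall[OF allL.prems wf] val_inst by blast
  then show ?case
    using allL.IH[OF allL.prems] unfolding subset_iff sat_add_left by blast
next
  case (allR \<Gamma> A \<Delta> C)
  have wf: "wf_fm L (Forall A)" "wf_fm L A" "\<forall>A\<in>#image_mset lift \<Gamma>. wf_fm L A"
    using cong_wf[OF allR.hyps(2)] LK_wf[OF allR.hyps(1)] by auto
  show ?case
  proof
    fix u
    assume u: "u \<in> sat \<sigma> \<phi> \<Gamma> (add_mset C \<Delta>)"
    have "u \<in> val (case_nat t \<sigma>) (case_nat e \<phi>) A" if "wf_tm L t" "e \<in> domain M" for t e
    proof -
      note env = case_nat_substs[OF allR.prems(1) that(1)] case_nat_assignments[OF allR.prems(2) that(2)]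
      have "u \<in> sat (case_nat t \<sigma>) (case_nat e \<phi>) (image_mset lift \<Gamma>) (image_mset lift \<Delta>)"
        using u by (simp add: sat_lift sat_add_right)
      then show ?thesis
        using sat_right[OF env allR.IH[OF env]] wf by blast
    qed
    then have "u \<in> val \<sigma> \<phi> C"
      unfolding val_cong[OF allR.prems allR.hyps(2)] val_Forall[OF allR.prems wf(1)] by blast
    then show "u \<in> provable"
      using u provable_if_both[of u "val \<sigma> \<phi> C"] by (simp add: sat_add_right)
  qed
next
  case (exL A \<Gamma> \<Delta> C)
  have wf: "wf_fm L (Exists A)" "wf_fm L A" "\<forall>A\<in>#image_mset lift \<Gamma>. wf_fm L A"
    using cong_wf[OF exL.hyps(2)] LK_wf[OF exL.hyps(1)] by auto
  show ?case
  proof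
    fix u
    assume u: "u \<in> sat \<sigma> \<phi> (add_mset C \<Gamma>) \<Delta>"
    have "u \<in> perp (val (case_nat t \<sigma>) (case_nat e \<phi>) A)" if "wf_tm L t" "e \<in> domain M" for t e
    proof -
      note env = case_nat_substs[OF exL.prems(1) that(1)] case_nat_assignments[OF exL.prems(2) that(2)]
      have "u \<in> sat (case_nat t \<sigma>) (case_nat e \<phi>) (image_mset lift \<Gamma>) (image_mset lift \<Delta>)"
        using u by (simp add: sat_lift sat_add_left)
      then show ?thesis
        using sat_left[OF env exL.IH[OF env]] wf by blast
    qed
    then have "u \<in> perp (val \<sigma> \<phi> C)"
      unfolding val_cong[OF exL.prems exL.hyps(2)] perp_val_Exists[OF exL.prems wf(1)] by blast
    then show "u \<in> provable"
      using u provable_if_both[of u "val \<sigma> \<phi> C"] by (simp add: sat_add_left)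
  qed
next
  case (exR \<Gamma> A t \<Delta> C)
  have wf: "wf_fm L (Exists A)"
    using cong_wf[OF exR.hyps(3)] by simp
  have "wf_tm L (subst_tm \<sigma> t)" "den_tm M \<phi> t \<in> domain M"
    using exR.prems exR.hyps(2) den_tm_domain[OF valued_structure_M] by (auto intro: wf_subst_tm)
  then have "perp (val \<sigma> \<phi> C) \<subseteq> perp (val \<sigma> \<phi> (inst A t))"
    unfolding val_cong[OF exR.prems exR.hyps(3)] perp_val_Exists[OF exR.prems wf] val_inst by blast
  then show ?case
    using exR.IH[OF exR.prems] unfolding subset_iff sat_add_right by blast
qed

text \<open>Under the substitution \<open>Var\<close> the index of \<open>val\<close> is
  \<open>A\<close> itself, so the candidate bounds put \<open>left A\<close> into the value of each
  hypothesis and \<open>right A\<close> into the orthogonal of each conclusion; weakening enlarges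
  both to the whole sequent.\<close>

lemma self_sat:
  assumes "\<phi> \<in> assignments" "(\<Gamma>, \<Delta>) \<in> seqs"
  shows "(\<Gamma>, \<Delta>) \<in> sat Var \<phi> \<Gamma> \<Delta>"
proof -
  have Var: "Var \<in> substs" by simp
  have "(\<Gamma>, \<Delta>) \<in> val Var \<phi> A" if A: "A \<in># \<Gamma>" for A
  proof -
    have wf: "wf_fm L A"
      using assms(2) A by (simp add: seqs_def)
    have "left A \<in> val Var \<phi> A"
      using val_candidate[OF Var assms(1) wf] by (simp add: candidate_def)
    moreover have "(\<Gamma> - {#A#}, \<Delta>) \<in> seqs"
      using assms(2) by (auto simp: seqs_def dest: in_diffD)
    ultimately have "left A + (\<Gamma> - {#A#}, \<Delta>) \<in> val Var \<phi> A"
      by (rule fact_weaken[OF val_fact[OF Var assms(1) wf]])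
    then show ?thesis
      using A by (simp add: left_def plus_prod_def)
  qed
  moreover have "(\<Gamma>, \<Delta>) \<in> perp (val Var \<phi> A)" if A: "A \<in># \<Delta>" for A
  proof -
    have wf: "wf_fm L A"
      using assms(2) A by (simp add: seqs_def)
    have "right A \<in> perp (val Var \<phi> A)"
      using candidate_right[OF val_candidate[OF Var assms(1) wf]] wf
      by (intro perpI) (simp_all add: right_seqs add.commute)
    moreover have "(\<Gamma>, \<Delta> - {#A#}) \<in> seqs"
      using assms(2) by (auto simp: seqs_def dest: in_diffD)
    ultimately have "right A + (\<Gamma>, \<Delta> - {#A#}) \<in> perp (val Var \<phi> A)"
      by (rule perp_weaken)
    then show ?thesis
      using A by (simp add: right_def plus_prod_def)
  qed
  ultimately show ?thesis
    using assms(2) by (simp add: sat_def)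
qed

lemma cut_elimination:
  assumes "LK True L R \<Gamma> \<Delta>"
  shows "LK False L R \<Gamma> \<Delta>"
proof -
  obtain d where "d \<in> domain M"
    using valued_structure_M by (auto simp: valued_structure_def)
  then have \<phi>: "(\<lambda>_. d) \<in> assignments" by auto
  have "(\<Gamma>, \<Delta>) \<in> seqs"
    using LK_wf[OF assms] by (simp add: seqs_def)
  then have "(\<Gamma>, \<Delta>) \<in> provable"
    using soundness[OF assms, of Var "\<lambda>_. d"] self_sat[OF \<phi>] \<phi> by auto
  then show ?thesis by (simp add: provable_def)
qed

end

theorem theorem2:
  fixes L :: "('f, 'p) language"
    and R :: "('f, 'p) rule set"
    and \<Gamma> \<Delta> :: "('f, 'p) fm multiset"
  assumes "proposition_rewrite_system L R"
    and "super_consistent TYPE(('f, 'p) truth_value) TYPE('m) L R"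
    and "LK True L R \<Gamma> \<Delta>"
  shows "LK False L R \<Gamma> \<Delta>"
proof -
  interpret rewrite_system L R by unfold_locales fact
  \<comment> \<open>Super-consistency is applied to a single algebra, the one built from cut-free
    provability in \<open>L\<close> and \<open>R\<close>.\<close>
  obtain M :: "('f, 'p, 'm, ('f, 'p) truth_value) struct" where "model L R alg M"
    using assms(2) alg_full_ordered_complete unfolding super_consistent_def by blast
  then interpret algebra_model L R M by unfold_locales
  show ?thesis
    using assms(3) by (rule cut_elimination)
qed

end
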